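(* Let $0\le\alpha<n$. Then for all locally integrable $f$ on $\mathbb{R}^n$ and all $x\in\mathbb{R}^n$, $$M_\alpha(Mf)(x)=\sup_{Q\ni x}|Q|^{\frac{\alpha-n}{n}}\int_Q Mf\;\approx\;\sup_{Q\ni x}|Q|^{\frac{\alpha}{n}}\|f\|_{L(1+\log^+L),Q}\;\approx\;\sup_{Q\ni x}|Q|^{\frac{\alpha-n}{n}}\int_Q|f|\left(1+\log^+\frac{|f|}{|f|_Q}\right),$$ where the suprema are over all cubes $Q$ containing $x$ and the constants in the equivalences are independent of $f$ and $x$.
   Context: Cubes in $\mathbb{R}^n$ have sides parallel to the coordinate axes; $\log^+t=\max\{\log t,0\}$; $|f|_Q=\frac1{|Q|}\int_Q|f|$ (if $|f|_Q=0$ the integrand $|f|(1+\log^+(|f|/|f|_Q))$ is read as $0$). $A\approx B$ means $c^{-1}B\le A\le cB$ for a positive constant $c$ (both sides may be infinite). The fractional maximal operator is $M_\alpha f(x)=\sup_{Q\ni x}|Q|^{\frac{\alpha-n}{n}}\int_Q|f(y)|\,dy$, and $M=M_0$ is the Hardy-Littlewood maximal operator. For a cube $Q$, $\|f\|_{L(1+\log^+L),Q}:=\inf\{\beta>0:\frac1{|Q|}\int_Q\frac{|f(x)|}{\beta}\left(1+\log^+\frac{|f(x)|}{\beta}\right)dx\le1\}$. *)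

theory Defs
  imports "HOL-Analysis.Analysis"
begin

text \<open>
  Functions may be only Lebesgue measurable, so \<open>lebesgue\<close> (not \<open>lborel\<close>) is used throughout.
  Quantities that may be infinite take values in \<open>ennreal\<close>.
\<close>

definition cubes :: "(real ^ 'n) set set" where
  "cubes = {cbox a (\<chi> i. a $ i + l) | a l. l > 0}"

definition cubes_at :: "real ^ 'n \<Rightarrow> (real ^ 'n) set set" where
  "cubes_at x = {Q \<in> cubes. x \<in> Q}"

abbreviation vol :: "(real ^ 'n) set \<Rightarrow> real" where
  "vol Q \<equiv> measure lebesgue Q"

definition locally_integrable :: "(real ^ 'n \<Rightarrow> real) \<Rightarrow> bool" where
  "locally_integrable f \<longleftrightarrow> (\<forall>K. compact K \<longrightarrow> set_integrable lebesgue K f)"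

text \<open>Since \<open>ln 0 = 0\<close> in the library, this also gives the intended value \<open>0\<close> at \<open>t = 0\<close>.\<close>

definition log_plus :: "real \<Rightarrow> real" where
  "log_plus t = max (ln t) 0"

text \<open>
  The maximal operators act on nonnegative extended-valued functions, so that \<open>M\<^sub>\<alpha>\<close> can be
  applied to \<open>Mf\<close>, which may be infinite. For real-valued \<open>f\<close> the argument is \<open>|f|\<close>.
\<close>

definition frac_maximal :: "real \<Rightarrow> (real ^ 'n \<Rightarrow> ennreal) \<Rightarrow> real ^ 'n \<Rightarrow> ennreal" where
  "frac_maximal \<alpha> g x =
     (SUP Q\<in>cubes_at x.
        ennreal (vol Q powr ((\<alpha> - real CARD('n)) / real CARD('n))) *
        (\<integral>\<^sup>+ y\<in>Q. g y \<partial>lebesgue))"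

definition HL_maximal :: "(real ^ 'n \<Rightarrow> real) \<Rightarrow> real ^ 'n \<Rightarrow> ennreal" where
  "HL_maximal f = frac_maximal 0 (\<lambda>y. ennreal \<bar>f y\<bar>)"

definition abs_avg :: "(real ^ 'n \<Rightarrow> real) \<Rightarrow> (real ^ 'n) set \<Rightarrow> real" where
  "abs_avg f Q = (1 / vol Q) * (LINT y:Q|lebesgue. \<bar>f y\<bar>)"

text \<open>The infimum is taken in \<open>ennreal\<close>, so it is \<open>\<infinity>\<close> when no \<open>\<beta>\<close> is admissible.\<close>

definition LlogL_norm :: "(real ^ 'n \<Rightarrow> real) \<Rightarrow> (real ^ 'n) set \<Rightarrow> ennreal" where
  "LlogL_norm f Q =
     Inf {ennreal \<beta> | \<beta>. \<beta> > 0 \<and>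
       ennreal (1 / vol Q) *
         (\<integral>\<^sup>+ y\<in>Q. ennreal (\<bar>f y\<bar> / \<beta> * (1 + log_plus (\<bar>f y\<bar> / \<beta>))) \<partial>lebesgue) \<le> 1}"

definition LlogL_integrand :: "(real ^ 'n \<Rightarrow> real) \<Rightarrow> (real ^ 'n) set \<Rightarrow> real ^ 'n \<Rightarrow> real" where
  "LlogL_integrand f Q y =
     (if abs_avg f Q = 0 then 0
      else \<bar>f y\<bar> * (1 + log_plus (\<bar>f y\<bar> / abs_avg f Q)))"

definition equiv_with :: "real \<Rightarrow> ennreal \<Rightarrow> ennreal \<Rightarrow> bool" where
  "equiv_with c A B \<longleftrightarrow> ennreal (inverse c) * B \<le> A \<and> A \<le> ennreal c * B"

end

theory Submission
  imports Defs
begin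

text \<open>
  Write \<open>A\<close> for the fractional maximal function of \<open>M f\<close> at \<open>x\<close>, \<open>B\<close> for the supremum of the scaled
  \<open>L log L\<close> norms and \<open>C\<close> for the supremum of the scaled means of \<open>|f| (1 + log_plus (|f| / |f|_Q))\<close>.
  The proof shows \<open>A \<le> K\<^sub>1 B\<close>, \<open>B \<le> C \<le> 2 B\<close> and \<open>C \<le> K\<^sub>2 A\<close> with constants that depend on the
  dimension only. In this sketch \<open>3Q\<close> is the cube \<open>Q\<close> dilated about its centre.
  
  The comparison of \<open>B\<close> and \<open>C\<close> holds on each cube separately and is elementary
  (\<open>LlogL_norm_le_mean\<close>, \<open>mean_le_LlogL_norm\<close>): the norm \<open>N\<close> and the average \<open>w\<close> of \<open>|f|\<close> satisfy
  \<open>w \<le> N\<close>, and exchanging one for the other inside the logarithm costs at most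
  \<open>w ln (N / w) \<le> N\<close>.
  
  The comparison with \<open>M f\<close> rests on a weak type inequality and its converse,
  \<open>t |{M g > t}| \<le> c \<integral> g 1{g > t / 2}\<close> and \<open>\<integral> g 1{g > t} \<le> c t |{M g > t}|\<close>
  (\<open>maximal_weak_type\<close>; \<open>maximal_reverse_weak_type\<close> together with \<open>null_above_maximal\<close>).
  Both come from Vitali's covering lemma. Summed over dyadic levels \<open>t\<close> they produce a logarithm,
  because the number of powers \<open>2 ^ k\<close> below \<open>s\<close> lies between \<open>log_plus s\<close> and \<open>2 (1 + log_plus s)\<close>.
  
  The first inequality, applied to \<open>f\<close> restricted to \<open>3Q\<close>, bounds the average over \<open>Q\<close> of the local part
  of \<open>M f\<close> by the norm on \<open>3Q\<close> (\<open>integral_local_maximal_le\<close>). The remaining part of \<open>M f\<close> comes from cubes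
  larger than \<open>Q\<close> and is controlled directly by \<open>B\<close> (\<open>maximal_le_local_plus_far\<close>). This gives
  \<open>A \<le> K\<^sub>1 B\<close>. The second inequality, applied to \<open>f\<close> restricted to \<open>Q\<close> at levels above the average, bounds
  the logarithmic integral over \<open>Q\<close> by the integral of \<open>M f\<close> over \<open>3Q\<close>
  (\<open>integral_log_plus_le_maximal\<close>), and this gives \<open>C \<le> K\<^sub>2 A\<close>.
\<close>

section \<open>Cubes and averages\<close>

text \<open>
  The default rule replaces the Lebesgue measure of a set by the Borel measure of its Borel part,
  which hides the cubes whose measures are compared below.
\<close>

declare emeasure_completion [simp del]


text \<open>
  The summation behind all three covering arguments below. In the two Vitali arguments the \<open>Q i\<close>
  are dilates of disjoint cubes \<open>P i\<close>; in the argument with dyadic cubes \<open>P i\<close> is the interior of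
  \<open>Q i\<close>. Keeping the two measures arbitrary lets one of them be Lebesgue measure and the other one
  have a density, in either role.
\<close>

lemma emeasure_countable_cover_le:
  fixes P Q :: "'i \<Rightarrow> 'a set"
  assumes "countable I" and sets: "sets \<nu> = sets \<mu>"
    and P: "\<And>i. i \<in> I \<Longrightarrow> P i \<in> sets \<mu>" and Q: "\<And>i. i \<in> I \<Longrightarrow> Q i \<in> sets \<mu>"
    and disj: "disjoint_family_on P I"
    and cover: "E \<subseteq> (\<Union>i\<in>I. Q i)" and sub: "\<And>i. i \<in> I \<Longrightarrow> P i \<subseteq> V" and V: "V \<in> sets \<mu>"
    and le: "\<And>i. i \<in> I \<Longrightarrow> emeasure \<nu> (Q i) \<le> c * emeasure \<mu> (P i)"
  shows "emeasure \<nu> E \<le> c * emeasure \<mu> V"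
proof -
  define J where "J = to_nat_on I ` I"
  define p where "p n = (if n \<in> J then P (from_nat_into I n) else {})" for n
  define q where "q n = (if n \<in> J then Q (from_nat_into I n) else {})" for n
  have inI: "from_nat_into I n \<in> I" if "n \<in> J" for n
    using that \<open>countable I\<close> by (auto simp: J_def)
  have dp: "disjoint_family p"
  proof -
    have "p m \<inter> p n = {}" if "m \<noteq> n" for m n
    proof (cases "m \<in> J \<and> n \<in> J")
      case True
      then have "from_nat_into I m \<noteq> from_nat_into I n"
        using that \<open>countable I\<close> by (auto simp: J_def)
      with True disj inI show ?thesis by (auto simp: p_def disjoint_family_on_def)
    qed (auto simp: p_def)
    then show ?thesis by (simp add: disjoint_family_on_def)
  qed
  have ps: "p n \<in> sets \<mu>" and qs: "q n \<in> sets \<nu>" for n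
    using P Q inI sets by (auto simp: p_def q_def)
  have "E \<subseteq> (\<Union>n. q n)"
  proof
    fix x assume "x \<in> E"
    then obtain i where i: "i \<in> I" "x \<in> Q i" using cover by auto
    then have "x \<in> q (to_nat_on I i)"
      using \<open>countable I\<close> by (auto simp: q_def J_def)
    then show "x \<in> (\<Union>n. q n)" by blast
  qed
  then have "emeasure \<nu> E \<le> emeasure \<nu> (\<Union>n. q n)"
    using qs by (intro emeasure_mono) auto
  also have "\<dots> \<le> (\<Sum>n. emeasure \<nu> (q n))"
    using qs by (intro emeasure_subadditive_countably) auto
  also have "\<dots> \<le> (\<Sum>n. c * emeasure \<mu> (p n))"
    using le inI by (intro suminf_le) (auto simp: p_def q_def)
  also have "\<dots> = c * emeasure \<mu> (\<Union>n. p n)"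
    using ps dp by (subst suminf_emeasure[symmetric]) auto
  also have "\<dots> \<le> c * emeasure \<mu> V"
    using sub inI V by (intro mult_left_mono emeasure_mono) (auto simp: p_def split: if_splits)
  finally show ?thesis .
qed

text \<open>
  Centre and half-side are the convenient parameters, because dilation keeps the centre fixed.
\<close>

definition cube :: "real ^ 'n \<Rightarrow> real \<Rightarrow> (real ^ 'n) set" where
  "cube c h = cbox (\<chi> i. c $ i - h) (\<chi> i. c $ i + h)"

lemma mem_cube: "y \<in> cube c h \<longleftrightarrow> (\<forall>i. \<bar>y $ i - c $ i\<bar> \<le> h)"
  unfolding cube_def by (simp add: mem_box_cart abs_le_iff) (smt (verit))

lemma cube_mono: "h \<le> h' \<Longrightarrow> cube c h \<subseteq> cube c h'"
proof
  fix y assume "h \<le> h'" and y: "y \<in> cube c h"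
  have "\<bar>y $ i - c $ i\<bar> \<le> h'" for i
    using y[unfolded mem_cube, rule_format, of i] \<open>h \<le> h'\<close> by (rule order_trans)
  then show "y \<in> cube c h'" by (simp add: mem_cube)
qed

lemma cube_in_cubes: "h > 0 \<Longrightarrow> cube c h \<in> cubes"
  unfolding cubes_def cube_def
  by (rule CollectI, rule exI[of _ "\<chi> i. c $ i - h"], rule exI[of _ "2 * h"])
     (simp add: algebra_simps)

lemma cubesE:
  assumes "Q \<in> cubes"
  obtains c h where "h > 0" "Q = cube c h"
proof -
  from assms obtain a l where l: "l > 0" and Q: "Q = cbox a (\<chi> i. a $ i + l)"
    by (auto simp: cubes_def)
  have "Q = cube (\<chi> i. a $ i + l / 2) (l / 2)"
    unfolding Q cube_def by (simp add: add.assoc)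
  with l that[of "l / 2"] show thesis by auto
qed

lemma cubes_at_iff: "Q \<in> cubes_at x \<longleftrightarrow> (\<exists>c h. h > 0 \<and> Q = cube c h \<and> x \<in> cube c h)"
  unfolding cubes_at_def by (auto intro: cube_in_cubes) (metis cubesE)

lemma vol_cube: "h \<ge> 0 \<Longrightarrow> vol (cube (c :: real ^ 'n) h) = (2 * h) ^ CARD('n)"
  unfolding cube_def by (simp add: content_cbox_if_cart interval_eq_empty_cart not_less)

lemma cube_lmeasurable [simp, intro]: "cube c h \<in> lmeasurable"
  unfolding cube_def by simp

lemma cube_sets [measurable, simp]: "cube c h \<in> sets lebesgue"
  using cube_lmeasurable by (rule fmeasurableD)

lemma compact_cube: "compact (cube c h)"
  unfolding cube_def by simp

lemma emeasure_cube: "emeasure lebesgue (cube c h) = ennreal (vol (cube c h))"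
  by (rule emeasure_eq_measure2) simp

lemma vol_cube_pos: "h > 0 \<Longrightarrow> vol (cube c h) > 0"
  by (simp add: vol_cube)

lemma vol_cube_mult:
  "h > 0 \<Longrightarrow> k > 0 \<Longrightarrow> vol (cube (c :: real ^ 'n) (k * h)) = k ^ CARD('n) * vol (cube (c' :: real ^ 'n) h)"
  by (simp add: vol_cube power_mult_distrib mult_ac)

text \<open>
  The superlevel sets of the maximal function, freed of the power of the volume and of the
  supremum: all later arguments compare \<open>t |Q|\<close> with the integral over \<open>Q\<close>.
\<close>

lemma less_frac_maximal_0_iff:
  fixes g :: "real ^ 'n \<Rightarrow> ennreal"
  assumes "t \<noteq> \<infinity>"
  shows "t < frac_maximal 0 g x \<longleftrightarrow>
    (\<exists>c h. h > 0 \<and> x \<in> cube c h \<and> t * emeasure lebesgue (cube c h) < (\<integral>\<^sup>+y\<in>cube c h. g y \<partial>lebesgue))"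
proof -
  have eq: "t < ennreal (vol (cube c h) powr ((0 - real CARD('n)) / real CARD('n))) * I \<longleftrightarrow>
      t * emeasure lebesgue (cube c h) < I" if "h > 0" for c :: "real ^ 'n" and h I
  proof -
    define v where "v = vol (cube c h)"
    have v: "v > 0" using that by (simp add: v_def vol_cube_pos)
    have "v powr ((0 - real CARD('n)) / real CARD('n)) = inverse v"
      using v by (simp add: powr_minus)
    then have "ennreal (v powr ((0 - real CARD('n)) / real CARD('n))) * I = I / ennreal v"
      using v by (simp add: divide_ennreal_def inverse_ennreal mult.commute)
    moreover have "t < I / ennreal v \<longleftrightarrow> t * ennreal v < I"
      using v by (cases t; cases I)
        (auto simp: divide_ennreal ennreal_mult[symmetric] ennreal_less_iff field_simps
          ennreal_top_mult ennreal_top_divide)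
    ultimately show ?thesis by (simp add: emeasure_cube v_def)
  qed
  show ?thesis
    unfolding frac_maximal_def less_SUP_iff Bex_def cubes_at_iff using eq by blast
qed

lemma cube_integral_le:
  assumes "frac_maximal 0 g x \<le> t" "t \<noteq> \<infinity>" "h > 0" "x \<in> cube c h"
  shows "(\<integral>\<^sup>+y\<in>cube c h. g y \<partial>lebesgue) \<le> t * emeasure lebesgue (cube c h)"
proof (rule ccontr)
  assume "\<not> ?thesis"
  then have "t < frac_maximal 0 g x"
    using less_frac_maximal_0_iff[OF assms(2), of g x] assms(3,4) by (auto simp: not_le)
  then show False using assms(1) by simp
qed

lemma average_le_maximal:
  assumes "h > 0" "x \<in> cube c h"
  shows "ennreal (1 / vol (cube c h)) * (\<integral>\<^sup>+y\<in>cube c h. g y \<partial>lebesgue) \<le> frac_maximal 0 g x"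
proof -
  have "vol (cube c h) powr ((0 - real CARD('a)) / real CARD('a)) = 1 / vol (cube c h)"
    using vol_cube_pos[OF assms(1), of c] by (simp add: powr_minus divide_inverse)
  moreover have "cube c h \<in> cubes_at x" using assms by (auto simp: cubes_at_iff)
  ultimately show ?thesis
    unfolding frac_maximal_def by (intro SUP_upper2[where i = "cube c h"]) auto
qed

section \<open>Vitali coverings by cubes\<close>

lemma cube_subset_cball: "cube (c :: real ^ 'n) h \<subseteq> cball c (real CARD('n) * h)"
proof
  fix y assume "y \<in> cube c h"
  then have *: "\<And>i. \<bar>(y - c) $ i\<bar> \<le> h" by (simp add: mem_cube)
  have "norm (y - c) \<le> (\<Sum>i\<in>UNIV. \<bar>(y - c) $ i\<bar>)" by (rule norm_le_l1_cart)
  also have "\<dots> \<le> (\<Sum>i\<in>(UNIV :: 'n set). h)" by (rule sum_mono) (rule *)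
  finally show "y \<in> cball c (real CARD('n) * h)"
    by (simp add: dist_norm norm_minus_commute)
qed

lemma ball_subset_cube: "ball c r \<subseteq> cube c r"
proof
  fix y assume "y \<in> ball c r"
  then have "norm (y - c) < r" by (simp add: dist_norm norm_minus_commute)
  then have "\<bar>(y - c) $ i\<bar> \<le> r" for i
    using component_le_norm_cart[of "y - c" i] by linarith
  then show "y \<in> cube c r" by (simp add: mem_cube)
qed

text \<open>
  The covering lemma for Euclidean balls is applied to balls that contain the cubes. Disjointness
  then passes to the cubes, and a ball enlarged five times lies in the cube dilated by
  \<open>5 * CARD('n)\<close>; the loss in the dilation factor only affects the constants.
\<close>

lemma Vitali_covering_lemma_cubes:
  fixes a :: "'i \<Rightarrow> real ^ 'n"
  assumes "\<And>i. i \<in> K \<Longrightarrow> 0 < h i \<and> h i \<le> B"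
  obtains C where "countable C" "C \<subseteq> K" "disjoint_family_on (\<lambda>i. cube (a i) (h i)) C"
    "\<And>i. i \<in> K \<Longrightarrow> \<exists>j\<in>C. cube (a i) (h i) \<subseteq> cube (a j) (5 * real CARD('n) * h j)"
proof -
  let ?r = "\<lambda>i. real CARD('n) * h i"
  have "0 < ?r i \<and> ?r i \<le> real CARD('n) * B" if "i \<in> K" for i
    using assms[OF that] by simp
  from Vitali_covering_lemma_cballs_balls[where K = K and a = a and r = ?r, OF this]
  obtain C where C: "countable C" "C \<subseteq> K"
      "pairwise (\<lambda>i j. disjnt (cball (a i) (?r i)) (cball (a j) (?r j))) C"
      "\<And>i. i \<in> K \<Longrightarrow> \<exists>j. j \<in> C \<and> \<not> disjnt (cball (a i) (?r i)) (cball (a j) (?r j)) \<and>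
         cball (a i) (?r i) \<subseteq> ball (a j) (5 * ?r j)"
    by blast
  have "disjoint_family_on (\<lambda>i. cube (a i) (h i)) C"
    unfolding disjoint_family_on_def
  proof (intro ballI impI)
    fix i j assume "i \<in> C" "j \<in> C" "i \<noteq> j"
    then have "cball (a i) (?r i) \<inter> cball (a j) (?r j) = {}"
      using C(3) by (auto simp: pairwise_def disjnt_def)
    then show "cube (a i) (h i) \<inter> cube (a j) (h j) = {}"
      using cube_subset_cball[of "a i" "h i"] cube_subset_cball[of "a j" "h j"] by blast
  qed
  moreover have "\<exists>j\<in>C. cube (a i) (h i) \<subseteq> cube (a j) (5 * real CARD('n) * h j)" if iK: "i \<in> K" for i
  proof -
    obtain j where j: "j \<in> C" "cball (a i) (?r i) \<subseteq> ball (a j) (5 * ?r j)"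
      using C(4)[OF iK] by blast
    have "cube (a i) (h i) \<subseteq> cube (a j) (5 * ?r j)"
      using cube_subset_cball j(2) ball_subset_cube by (rule order_trans[OF order_trans])
    then show ?thesis using j(1) by (auto simp: mult.assoc)
  qed
  ultimately show thesis using that C(1,2) by blast
qed

text \<open>
  The weak type inequality is the case where \<open>\<nu>\<close> is Lebesgue measure and \<open>\<mu>\<close> has a density;
  its converse is the case where the roles are exchanged.
\<close>

lemma Vitali_measure_comparison:
  fixes \<mu> \<nu> :: "(real ^ 'n) measure"
  assumes sets: "sets \<mu> = sets lebesgue" "sets \<nu> = sets lebesgue" and V: "V \<in> sets lebesgue"
    and cov: "\<And>x. x \<in> E \<Longrightarrow> \<exists>c h. 0 < h \<and> h \<le> B \<and> x \<in> cube c h \<and> cube c h \<subseteq> V \<and>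
      emeasure \<nu> (cube c (5 * real CARD('n) * h)) \<le> k * emeasure \<mu> (cube c h)"
  shows "emeasure \<nu> E \<le> k * emeasure \<mu> V"
proof -
  obtain a h where ah: "\<And>x. x \<in> E \<Longrightarrow> 0 < h x \<and> h x \<le> B \<and> x \<in> cube (a x) (h x) \<and>
      cube (a x) (h x) \<subseteq> V \<and>
      emeasure \<nu> (cube (a x) (5 * real CARD('n) * h x)) \<le> k * emeasure \<mu> (cube (a x) (h x))"
    using cov by metis
  have "0 < h x \<and> h x \<le> B" if "x \<in> E" for x
    using ah[OF that] by blast
  from Vitali_covering_lemma_cubes[of E h B a, OF this]
  obtain C where C: "countable C" "C \<subseteq> E" "disjoint_family_on (\<lambda>x. cube (a x) (h x)) C"
    "\<And>x. x \<in> E \<Longrightarrow> \<exists>y\<in>C. cube (a x) (h x) \<subseteq> cube (a y) (5 * real CARD('n) * h y)"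
    by blast
  show ?thesis
  proof (rule emeasure_countable_cover_le[OF C(1), where P = "\<lambda>x. cube (a x) (h x)"
        and Q = "\<lambda>x. cube (a x) (5 * real CARD('n) * h x)"])
    show "E \<subseteq> (\<Union>x\<in>C. cube (a x) (5 * real CARD('n) * h x))"
    proof
      fix x assume "x \<in> E"
      then obtain y where "y \<in> C" "cube (a x) (h x) \<subseteq> cube (a y) (5 * real CARD('n) * h y)"
        using C(4)[of x] by blast
      moreover have "x \<in> cube (a x) (h x)" using ah[OF \<open>x \<in> E\<close>] by blast
      ultimately show "x \<in> (\<Union>x\<in>C. cube (a x) (5 * real CARD('n) * h x))" by blast
    qed
    show "cube (a x) (h x) \<subseteq> V" if "x \<in> C" for x
      using ah[of x] that C(2) by blast
    show "emeasure \<nu> (cube (a x) (5 * real CARD('n) * h x)) \<le> k * emeasure \<mu> (cube (a x) (h x))"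
      if "x \<in> C" for x
      using ah[of x] that C(2) by blast
    show "sets \<nu> = sets \<mu>" using sets by simp
    show "disjoint_family_on (\<lambda>x. cube (a x) (h x)) C" by (fact C(3))
    show "V \<in> sets \<mu>" using sets V by simp
  qed (unfold sets, (rule cube_sets)+)
qed

section \<open>Weak type inequalities for the maximal function\<close>

text \<open>
  A strict inequality between \<open>t |Q|\<close> and the integral over \<open>Q\<close> survives a slight dilation of \<open>Q\<close>,
  since the volume is continuous in the half-side and the integral does not decrease. The dilated
  cube contains a neighbourhood of every point of \<open>Q\<close>.
\<close>

lemma open_maximal_superlevel:
  fixes g :: "real ^ 'n \<Rightarrow> ennreal"
  shows "open {x. t < frac_maximal 0 g x}"
proof (cases t)
  case (real r)
  show ?thesis
  proof (rule openI)
    fix x assume "x \<in> {x. t < frac_maximal 0 g x}"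
    then obtain c h where h: "h > 0" "x \<in> cube c h"
      and lt: "t * emeasure lebesgue (cube c h) < (\<integral>\<^sup>+y\<in>cube c h. g y \<partial>lebesgue)"
      using less_frac_maximal_0_iff[of t g x] real by auto
    have eq: "t * emeasure lebesgue (cube c s) = ennreal (r * (2 * s) ^ CARD('n))" if "s > 0" for s
      using that real by (simp add: emeasure_cube vol_cube ennreal_mult)
    have "((\<lambda>s. ennreal (r * (2 * s) ^ CARD('n))) \<longlongrightarrow> ennreal (r * (2 * h) ^ CARD('n))) (at_right h)"
      by (intro tendsto_ennrealI tendsto_intros)
    with lt have "\<forall>\<^sub>F s in at_right h. ennreal (r * (2 * s) ^ CARD('n)) < (\<integral>\<^sup>+y\<in>cube c h. g y \<partial>lebesgue)"
      using eq[OF h(1)] by (auto intro: order_tendstoD(2))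
    then have "\<forall>\<^sub>F s in at_right h. ennreal (r * (2 * s) ^ CARD('n)) < (\<integral>\<^sup>+y\<in>cube c h. g y \<partial>lebesgue) \<and> h < s"
      using eventually_at_right_less by (rule eventually_conj)
    then obtain s where s: "h < s" "ennreal (r * (2 * s) ^ CARD('n)) < (\<integral>\<^sup>+y\<in>cube c h. g y \<partial>lebesgue)"
      using eventually_happens'[OF trivial_limit_at_right_real] by blast
    have sub: "cube c h \<subseteq> cube c s"
      using s(1) by (intro cube_mono) simp
    then have "(\<integral>\<^sup>+y\<in>cube c h. g y \<partial>lebesgue) \<le> (\<integral>\<^sup>+y\<in>cube c s. g y \<partial>lebesgue)"
      by (intro nn_integral_mono) (auto split: split_indicator)
    with s have lt': "t * emeasure lebesgue (cube c s) < (\<integral>\<^sup>+y\<in>cube c s. g y \<partial>lebesgue)"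
      using eq[of s] h by auto
    have "ball x (s - h) \<subseteq> {x. t < frac_maximal 0 g x}"
    proof
      fix y assume "y \<in> ball x (s - h)"
      then have "y \<in> cube x (s - h)" using ball_subset_cube by blast
      then have "\<bar>y $ i - x $ i\<bar> \<le> s - h" "\<bar>x $ i - c $ i\<bar> \<le> h" for i
        using h by (auto simp: mem_cube)
      then have "\<bar>y $ i - x $ i\<bar> + \<bar>x $ i - c $ i\<bar> \<le> s" for i
        by (metis add_mono diff_add_cancel)
      then have "\<bar>y $ i - c $ i\<bar> \<le> s" for i
        using abs_triangle_ineq[of "y $ i - x $ i" "x $ i - c $ i"] order_trans by fastforce
      then have "y \<in> cube c s" by (simp add: mem_cube)
      then show "y \<in> {x. t < frac_maximal 0 g x}"
        using lt' s h real less_frac_maximal_0_iff[of t g y] by force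
    qed
    then show "\<exists>e>0. ball x e \<subseteq> {x. t < frac_maximal 0 g x}"
      using s by (intro exI[of _ "s - h"]) auto
  qed
qed auto

lemma borel_measurable_maximal [measurable]: "frac_maximal 0 g \<in> borel_measurable lebesgue"
proof -
  have "frac_maximal 0 g \<in> borel_measurable lborel"
  proof (rule borel_measurableI_greater)
    fix t
    show "{x \<in> space lborel. t < frac_maximal 0 g x} \<in> sets lborel"
      using borel_open[OF open_maximal_superlevel[of t g]] by simp
  qed
  then show ?thesis by (rule measurable_completion)
qed

lemma sets_maximal_superlevel [measurable]: "{x. t < frac_maximal 0 g x} \<in> sets lebesgue"
  using open_maximal_superlevel[of t g] by (simp add: borel_open)

text \<open>
  Vitali's lemma needs bounded radii, and the near-maximal cubes chosen below need a finite supremum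
  of half-sides.
\<close>

lemma half_side_bounded:
  fixes c :: "real ^ 'n"
  assumes "t > 0" "I \<noteq> \<infinity>" and lt: "ennreal t * emeasure lebesgue (cube c h) < I" and "h > 0"
  shows "h \<le> 1 + enn2real I / t"
proof (cases "2 * h \<le> 1")
  case True
  moreover have "0 \<le> enn2real I / t" using \<open>t > 0\<close> by simp
  ultimately show ?thesis by linarith
next
  case False
  obtain J where J: "I = ennreal J" "J \<ge> 0" using \<open>I \<noteq> \<infinity>\<close> by (cases I) auto
  have "t * (2 * h) ^ CARD('n) < J"
    using lt J assms by (simp add: emeasure_cube vol_cube ennreal_mult[symmetric] ennreal_less_iff)
  moreover have "2 * h \<le> (2 * h) ^ CARD('n)"
    using False by (intro self_le_power) (auto simp: Suc_le_eq)
  ultimately have "t * (2 * h) \<le> J"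
    using \<open>t > 0\<close> by (smt (verit) mult_left_mono)
  then have "2 * h \<le> J / t" using \<open>t > 0\<close> by (simp add: field_simps)
  then show ?thesis using J \<open>h > 0\<close> by simp
qed

text \<open>
  The part of \<open>g\<close> below \<open>t / 2\<close> contributes at most \<open>t / 2\<close> to any average. Hence on a cube with
  average above \<open>t\<close> the part above \<open>t / 2\<close> still has average above \<open>t / 2\<close>, and Vitali's lemma
  applies to these cubes. The truncation of \<open>g\<close> on the right-hand side is what produces a logarithm
  when the inequality is summed over \<open>t\<close>.
\<close>

lemma maximal_weak_type:
  fixes g :: "real ^ 'n \<Rightarrow> ennreal"
  assumes g [measurable]: "g \<in> borel_measurable lebesgue" and fin: "(\<integral>\<^sup>+x. g x \<partial>lebesgue) \<noteq> \<infinity>"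
    and t: "t > 0"
  shows "emeasure lebesgue {x. ennreal t < frac_maximal 0 g x} \<le>
    ennreal (2 * (5 * real CARD('n)) ^ CARD('n) / t) *
    (\<integral>\<^sup>+x. g x * indicator {x. ennreal (t / 2) < g x} x \<partial>lebesgue)"
proof -
  let ?D = "5 * real CARD('n)"
  let ?g = "\<lambda>x. g x * indicator {x. ennreal (t / 2) < g x} x"
  have [measurable]: "?g \<in> borel_measurable lebesgue" by measurable
  have "emeasure lebesgue {x. ennreal t < frac_maximal 0 g x} \<le>
      ennreal (2 * ?D ^ CARD('n) / t) * emeasure (density lebesgue ?g) UNIV"
  proof (rule Vitali_measure_comparison)
    fix x assume "x \<in> {x. ennreal t < frac_maximal 0 g x}"
    then obtain c h where h: "h > 0" "x \<in> cube c h"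
      and lt: "ennreal t * emeasure lebesgue (cube c h) < (\<integral>\<^sup>+y\<in>cube c h. g y \<partial>lebesgue)"
      using less_frac_maximal_0_iff[of "ennreal t" g x] by auto
    have "(\<integral>\<^sup>+y\<in>cube c h. g y \<partial>lebesgue) \<le> (\<integral>\<^sup>+x. g x \<partial>lebesgue)"
      by (intro nn_integral_mono) (auto split: split_indicator)
    with lt have bd: "h \<le> 1 + enn2real (\<integral>\<^sup>+x. g x \<partial>lebesgue) / t"
      using half_side_bounded[OF t fin _ h(1)] by (meson order_less_le_trans)
    define v where "v = vol (cube c h)"
    have v: "v > 0" "emeasure lebesgue (cube c h) = ennreal v"
      using h by (auto simp: v_def vol_cube_pos emeasure_cube)
    define J where "J = (\<integral>\<^sup>+y\<in>cube c h. ?g y \<partial>lebesgue)"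
    have "ennreal (t * v) < (\<integral>\<^sup>+y\<in>cube c h. g y \<partial>lebesgue)"
      using lt v t by (simp add: ennreal_mult)
    also have "\<dots> \<le> (\<integral>\<^sup>+y. ?g y * indicator (cube c h) y + ennreal (t / 2) * indicator (cube c h) y \<partial>lebesgue)"
      by (intro nn_integral_mono) (auto split: split_indicator)
    also have "\<dots> = J + ennreal (t / 2) * ennreal v"
      unfolding J_def v(2)[symmetric] by (subst nn_integral_add) (auto simp: nn_integral_cmult_indicator)
    also have "ennreal (t / 2) * ennreal v = ennreal (t / 2 * v)"
      using t v by (intro ennreal_mult[symmetric]) auto
    finally have "ennreal (t * v) < J + ennreal (t / 2 * v)" .
    then have "ennreal v \<le> ennreal (2 / t) * J"
      using t v by (cases J) (auto simp: ennreal_mult[symmetric] ennreal_plus[symmetric] ennreal_less_iff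
          ennreal_mult_top field_simps simp del: ennreal_plus)
    then have "ennreal (?D ^ CARD('n)) * ennreal v \<le> ennreal (?D ^ CARD('n)) * (ennreal (2 / t) * J)"
      by (rule mult_left_mono) simp
    also have "\<dots> = ennreal (2 * ?D ^ CARD('n) / t) * J"
    proof -
      have "ennreal (2 * ?D ^ CARD('n) / t) = ennreal (?D ^ CARD('n)) * ennreal (2 / t)"
        using t by (subst ennreal_mult[symmetric]) auto
      then show ?thesis by (simp add: mult.assoc)
    qed
    finally have "ennreal (?D ^ CARD('n) * v) \<le> ennreal (2 * ?D ^ CARD('n) / t) * J"
      using v by (simp add: ennreal_mult)
    moreover have "emeasure lebesgue (cube c (?D * h)) = ennreal (?D ^ CARD('n) * v)"
      using h by (simp add: emeasure_cube v_def vol_cube_mult[of h ?D c c])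
    ultimately show "\<exists>c h. 0 < h \<and> h \<le> 1 + enn2real (\<integral>\<^sup>+x. g x \<partial>lebesgue) / t \<and> x \<in> cube c h \<and> cube c h \<subseteq> UNIV \<and>
        emeasure lebesgue (cube c (?D * h)) \<le>
        ennreal (2 * ?D ^ CARD('n) / t) * emeasure (density lebesgue ?g) (cube c h)"
      using h bd by (intro exI[of _ c] exI[of _ h]) (auto simp: emeasure_density J_def)
  qed auto
  then show ?thesis by (simp add: emeasure_density)
qed

text \<open>
  The converse inequality replaces a stopping time argument on dyadic cubes. Around each point of the
  superlevel set a cube with average above \<open>t\<close> is chosen whose half-side is more than half of the
  supremum over all such cubes. Its Vitali dilate is then too large to have average above \<open>t\<close>, so that its
  integral is at most \<open>t\<close> times its volume, while the cube itself lies in the superlevel set.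
\<close>

lemma maximal_reverse_weak_type:
  fixes g :: "real ^ 'n \<Rightarrow> ennreal"
  assumes g [measurable]: "g \<in> borel_measurable lebesgue" and fin: "(\<integral>\<^sup>+x. g x \<partial>lebesgue) \<noteq> \<infinity>"
    and t: "t > 0"
  shows "(\<integral>\<^sup>+x\<in>{x. ennreal t < frac_maximal 0 g x}. g x \<partial>lebesgue) \<le>
    ennreal ((5 * real CARD('n)) ^ CARD('n) * t) * emeasure lebesgue {x. ennreal t < frac_maximal 0 g x}"
proof -
  let ?D = "5 * real CARD('n)" and ?U = "{x. ennreal t < frac_maximal 0 g x}"
  let ?B = "1 + enn2real (\<integral>\<^sup>+x. g x \<partial>lebesgue) / t"
  have "emeasure (density lebesgue g) ?U \<le> ennreal (?D ^ CARD('n) * t) * emeasure lebesgue ?U"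
  proof (rule Vitali_measure_comparison)
    fix x assume "x \<in> ?U"
    define S where "S = {h. h > 0 \<and> (\<exists>c. x \<in> cube c h \<and>
      ennreal t * emeasure lebesgue (cube c h) < (\<integral>\<^sup>+y\<in>cube c h. g y \<partial>lebesgue))}"
    have "S \<noteq> {}"
      using \<open>x \<in> ?U\<close> less_frac_maximal_0_iff[of "ennreal t" g x] by (auto simp: S_def)
    have bd: "h \<le> ?B" if hS: "h \<in> S" for h
    proof -
      obtain c where c: "h > 0" "ennreal t * emeasure lebesgue (cube c h) < (\<integral>\<^sup>+y\<in>cube c h. g y \<partial>lebesgue)"
        using hS by (auto simp: S_def)
      have "(\<integral>\<^sup>+y\<in>cube c h. g y \<partial>lebesgue) \<le> (\<integral>\<^sup>+x. g x \<partial>lebesgue)"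
        by (intro nn_integral_mono) (auto split: split_indicator)
      with c show ?thesis
        using half_side_bounded[OF t fin _ c(1)] by (meson order_less_le_trans)
    qed
    then have bdd: "bdd_above S" by (rule bdd_aboveI)
    obtain h0 where "h0 \<in> S" using \<open>S \<noteq> {}\<close> by blast
    then have "Sup S > 0" using bdd cSup_upper[of h0 S] by (auto simp: S_def)
    then have "Sup S / 2 < Sup S" by simp
    then obtain h where h: "h \<in> S" "Sup S / 2 < h"
      using less_cSupD[OF \<open>S \<noteq> {}\<close>] by blast
    then obtain c where c: "h > 0" "x \<in> cube c h"
        "ennreal t * emeasure lebesgue (cube c h) < (\<integral>\<^sup>+y\<in>cube c h. g y \<partial>lebesgue)"
      by (auto simp: S_def)
    have "1 \<le> real CARD('n)" by (simp add: Suc_le_eq)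
    \<comment> \<open>Dilation by a factor greater than 2 suffices to exceed the supremum of the half-sides.\<close>
    then have D: "5 * h \<le> ?D * h" "0 < ?D" using c(1) by auto
    then have "h \<le> ?D * h" using c(1) by linarith
    have "Sup S < ?D * h" using D(1) h(2) c(1) by linarith
    then have "?D * h \<notin> S" using cSup_upper[OF _ bdd] by force
    moreover have "x \<in> cube c (?D * h)"
      using c(2) cube_mono[OF \<open>h \<le> ?D * h\<close>] by blast
    ultimately have "(\<integral>\<^sup>+y\<in>cube c (?D * h). g y \<partial>lebesgue) \<le> ennreal t * emeasure lebesgue (cube c (?D * h))"
      using c(1) \<open>0 < ?D\<close> by (auto simp: S_def not_less)
    also have "\<dots> = ennreal (?D ^ CARD('n) * t) * emeasure lebesgue (cube c h)"
      using c(1) t unfolding emeasure_cube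
      by (subst vol_cube_mult[of h ?D c c]) (auto simp: ennreal_mult[symmetric] mult_ac)
    finally have le: "emeasure (density lebesgue g) (cube c (?D * h)) \<le>
        ennreal (?D ^ CARD('n) * t) * emeasure lebesgue (cube c h)"
      by (simp add: emeasure_density)
    have "cube c h \<subseteq> ?U"
      using c less_frac_maximal_0_iff[of "ennreal t" g] by force
    with le c bd[OF h(1)] show "\<exists>c h. 0 < h \<and> h \<le> ?B \<and> x \<in> cube c h \<and> cube c h \<subseteq> ?U \<and>
        emeasure (density lebesgue g) (cube c (?D * h)) \<le>
        ennreal (?D ^ CARD('n) * t) * emeasure lebesgue (cube c h)"
      by blast
  qed auto
  then show ?thesis by (simp add: emeasure_density)
qed

text \<open>
  Dyadic covering theorems provide boxes given by their corners.
\<close>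

lemma cbox_is_cube:
  fixes a b :: "real ^ 'n"
  assumes "\<And>i. b $ i - a $ i = l"
  shows "cbox a b = cube (\<chi> i. (a $ i + b $ i) / 2) (l / 2)"
proof -
  have "a $ i = (a $ i + b $ i) / 2 - l / 2" "b $ i = (a $ i + b $ i) / 2 + l / 2" for i
    using assms[of i] by (auto simp: field_simps)
  then have "a = (\<chi> i. (\<chi> i. (a $ i + b $ i) / 2) $ i - l / 2)" "b = (\<chi> i. (\<chi> i. (a $ i + b $ i) / 2) $ i + l / 2)"
    by (auto simp: vec_eq_iff)
  then show ?thesis unfolding cube_def by simp
qed

text \<open>
  This is the inequality \<open>g \<le> M g\<close> almost everywhere, at a single level \<open>t\<close>, obtained here
  without a differentiation theorem. Let \<open>E\<close> be the exceptional set. An open superset \<open>V\<close> of almost the same measure contains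
  nonoverlapping dyadic cubes that cover \<open>E\<close> and each meet \<open>E\<close>. On each of them the average of
  \<open>g\<close> is at most \<open>t\<close>, because it contains a point where the maximal function is at most \<open>t\<close>. So the
  integral of \<open>g\<close> over \<open>E\<close> is at most \<open>t |E|\<close>, which contradicts \<open>g > t\<close> on \<open>E\<close> unless \<open>|E| = 0\<close>.
\<close>

lemma null_above_maximal:
  fixes g :: "real ^ 'n \<Rightarrow> ennreal"
  assumes g [measurable]: "g \<in> borel_measurable lebesgue" and t: "t > 0" and H: "H > 0"
  shows "emeasure lebesgue {x \<in> cube c H. frac_maximal 0 g x \<le> ennreal t \<and> ennreal t < g x} = 0"
proof -
  define E where "E = {x \<in> cube c H. frac_maximal 0 g x \<le> ennreal t \<and> ennreal t < g x}"
  have [measurable]: "E \<in> sets lebesgue"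
    unfolding E_def by measurable
  have "emeasure lebesgue E \<le> emeasure lebesgue (cube c H)"
    by (intro emeasure_mono) (auto simp: E_def)
  then have finE: "emeasure lebesgue E < \<infinity>"
    by (simp add: emeasure_cube order_le_less_trans)
  have approx: "(\<integral>\<^sup>+x\<in>E. g x \<partial>lebesgue) \<le> ennreal t * (emeasure lebesgue E + ennreal e)" if e: "e > 0" for e
  proof -
    obtain V where V: "open V" "E \<subseteq> V" "V - E \<in> lmeasurable" "emeasure lebesgue (V - E) < ennreal e"
      using sets_lebesgue_outer_open[OF \<open>E \<in> sets lebesgue\<close> e] by blast
    define a b where ab: "a = (\<chi> i. c $ i - H)" "b = (\<chi> i. c $ i + H)"
    have "E \<subseteq> cbox a b" by (auto simp: E_def cube_def ab)
    moreover have "box a b \<noteq> {}" using H by (simp add: ab interval_ne_empty_cart)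
    \<comment> \<open>The gauge only matters at points of \<open>E\<close>, where it confines the dyadic cubes to \<open>V\<close>.\<close>
    moreover have "gauge (\<lambda>x. if x \<in> V then V else UNIV)"
      using V(1) by (auto simp: gauge_def)
    ultimately obtain \<D> where D: "countable \<D>" "\<Union>\<D> \<subseteq> cbox a b"
      "\<And>K. K \<in> \<D> \<Longrightarrow> interior K \<noteq> {} \<and> (\<exists>c d. K = cbox c d)"
      "pairwise (\<lambda>A B. interior A \<inter> interior B = {}) \<D>"
      "\<And>K. K \<in> \<D> \<Longrightarrow> \<exists>x \<in> E \<inter> K. K \<subseteq> (if x \<in> V then V else UNIV)"
      "\<And>u v. cbox u v \<in> \<D> \<Longrightarrow> \<exists>n. \<forall>i \<in> Basis. v \<bullet> i - u \<bullet> i = (b \<bullet> i - a \<bullet> i) / 2^n"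
      "E \<subseteq> \<Union>\<D>"
      by (rule covering_lemma) (rule that)
    have K: "K \<in> sets lebesgue \<and> interior K \<subseteq> V \<and>
        emeasure (density lebesgue g) K \<le> ennreal t * emeasure lebesgue (interior K)" if KD: "K \<in> \<D>" for K
    proof -
      obtain u v where uv: "K = cbox u v" using D(3)[OF KD] by blast
      obtain n where n: "\<forall>i \<in> Basis. v \<bullet> i - u \<bullet> i = (b \<bullet> i - a \<bullet> i) / 2^n"
        using D(6)[of u v] KD uv by blast
      have "v $ i - u $ i = 2 * H / 2 ^ n" for i
        using n[rule_format, of "axis i 1"] by (simp add: inner_axis ab)
      then obtain c' where c': "K = cube c' (H / 2 ^ n)"
        unfolding uv using cbox_is_cube[of v u "2 * H / 2 ^ n"] by auto
      obtain x where x: "x \<in> E" "x \<in> K" "K \<subseteq> V"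
        using D(5)[OF KD] V(2) by auto
      have "frac_maximal 0 g x \<le> ennreal t" using x(1) by (simp add: E_def)
      then have le: "(\<integral>\<^sup>+y\<in>K. g y \<partial>lebesgue) \<le> ennreal t * emeasure lebesgue K"
        using x(2) H unfolding c' by (intro cube_integral_le) auto
      have "emeasure lebesgue (interior K) = emeasure lebesgue K"
        unfolding uv interior_cbox
        by (simp add: emeasure_completion emeasure_lborel_box_eq emeasure_lborel_cbox_eq)
      with le x(3) show ?thesis
        using interior_subset[of K] by (auto simp: emeasure_density c')
    qed
    have "emeasure (density lebesgue g) E \<le> ennreal t * emeasure lebesgue V"
    proof (rule emeasure_countable_cover_le[OF D(1), where P = interior and Q = "\<lambda>K. K"])
      show "disjoint_family_on interior \<D>"
        using D(4) by (auto simp: disjoint_family_on_def pairwise_def)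
      show "E \<subseteq> (\<Union>K\<in>\<D>. K)" using D(7) by simp
    qed (use K V(1) in \<open>auto simp: borel_open\<close>)
    also have "emeasure lebesgue V \<le> emeasure lebesgue E + emeasure lebesgue (V - E)"
      using emeasure_subadditive[of E lebesgue "V - E"] V by (simp add: Un_absorb1 fmeasurableD)
    also have "\<dots> \<le> emeasure lebesgue E + ennreal e"
      using V(4) by (intro add_left_mono) simp
    finally show ?thesis
      by (simp add: emeasure_density mult_left_mono)
  qed
  have le: "(\<integral>\<^sup>+x\<in>E. g x \<partial>lebesgue) \<le> ennreal t * emeasure lebesgue E"
  proof (rule ennreal_le_epsilon)
    fix e :: real assume "e > 0"
    then have "(\<integral>\<^sup>+x\<in>E. g x \<partial>lebesgue) \<le> ennreal t * (emeasure lebesgue E + ennreal (e / t))"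
      using t by (intro approx) simp
    also have "\<dots> = ennreal t * emeasure lebesgue E + ennreal e"
      using t \<open>e > 0\<close> by (simp add: distrib_left ennreal_mult[symmetric])
    finally show "(\<integral>\<^sup>+x\<in>E. g x \<partial>lebesgue) \<le> ennreal t * emeasure lebesgue E + ennreal e" .
  qed
  have "(\<integral>\<^sup>+x. (g x - ennreal t) * indicator E x \<partial>lebesgue) + ennreal t * emeasure lebesgue E =
      (\<integral>\<^sup>+x. (g x - ennreal t) * indicator E x + ennreal t * indicator E x \<partial>lebesgue)"
    by (subst nn_integral_add) (auto simp: nn_integral_cmult_indicator)
  also have "\<dots> = (\<integral>\<^sup>+x\<in>E. g x \<partial>lebesgue)"
    by (intro nn_integral_cong) (auto simp: E_def diff_add_cancel_ennreal split: split_indicator)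
  finally have "(\<integral>\<^sup>+x. (g x - ennreal t) * indicator E x \<partial>lebesgue) + ennreal t * emeasure lebesgue E
      \<le> 0 + ennreal t * emeasure lebesgue E"
    using le by simp
  then have "(\<integral>\<^sup>+x. (g x - ennreal t) * indicator E x \<partial>lebesgue) = 0"
    using finE unfolding add.commute[of _ "ennreal t * emeasure lebesgue E"] ennreal_add_left_cancel_le
    by (auto simp: ennreal_mult_eq_top_iff)
  then have "AE x in lebesgue. (g x - ennreal t) * indicator E x = 0"
    by (subst (asm) nn_integral_0_iff_AE) auto
  then have "AE x in lebesgue. x \<notin> E"
    by eventually_elim (auto simp: E_def diff_eq_0_iff_ennreal split: split_indicator_asm)
  then show ?thesis
    unfolding E_def[symmetric] by (subst (asm) AE_iff_measurable[OF \<open>E \<in> sets lebesgue\<close>]) auto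
qed

section \<open>Dyadic layers\<close>

text \<open>
  Sums over the levels \<open>2 ^ k * b\<close> replace the layer cake integral over all levels above \<open>b\<close>, so that
  interchanging a series with an integral takes the place of Fubini's theorem. In the proof \<open>s\<close> is
  truncated at \<open>2 ^ n * b\<close> to make an induction on the number of layers possible; this also covers
  \<open>s = \<infinity>\<close>.
\<close>

lemma dyadic_layers_ge:
  fixes s :: ennreal
  assumes b: "b > 0"
  shows "s \<le> ennreal b + (\<Sum>k. ennreal (2 ^ k * b) * indicator {ennreal (2 ^ k * b)<..} s)"
proof -
  let ?a = "\<lambda>k. ennreal (2 ^ k * b) * indicator {ennreal (2 ^ k * b)<..} s"
  have "min s (ennreal (2 ^ n * b)) \<le> ennreal b + (\<Sum>k<n. ?a k)" for n
  proof (induction n)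
    case (Suc n)
    show ?case
    proof (cases "s \<le> ennreal (2 ^ n * b)")
      case True
      then have "min s (ennreal (2 ^ Suc n * b)) \<le> min s (ennreal (2 ^ n * b))"
        by (simp only: min.absorb1[OF True] min.cobounded1)
      moreover have "?a n = 0" using True by (simp add: not_less)
      ultimately show ?thesis using Suc by (simp only: sum.lessThan_Suc add_0_right)
    next
      case False
      have "ennreal (2 ^ Suc n * b) = ennreal (2 ^ n * b) + ennreal (2 ^ n * b)"
        using b by (simp flip: ennreal_plus)
      also have "\<dots> \<le> (ennreal b + (\<Sum>k<n. ?a k)) + ennreal (2 ^ n * b)"
        using Suc False by (intro add_right_mono) (simp add: min_def split: if_splits)
      also have "\<dots> = ennreal b + (\<Sum>k<Suc n. ?a k)" using False by (simp add: not_le add.assoc)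
      finally show ?thesis by (rule min.coboundedI2)
    qed
  qed simp
  also have "ennreal b + (\<Sum>k<n. ?a k) \<le> ennreal b + (\<Sum>k. ?a k)" for n
    by (intro add_left_mono sum_le_suminf) auto
  finally have le: "min s (ennreal (2 ^ n * b)) \<le> ennreal b + (\<Sum>k. ?a k)" for n .
  have unbounded: "\<exists>n. r < 2 ^ n * b" for r :: real
    using real_arch_pow[of 2 "r / b"] b by (auto simp: field_simps)
  show ?thesis
  proof (cases s)
    case (real r)
    with unbounded[of r] obtain n where "r < 2 ^ n * b" by blast
    then show ?thesis using le[of n] real b by (simp add: min_def)
  next
    case top
    have "ennreal b + (\<Sum>k. ?a k) = \<infinity>"
    proof (rule ccontr)
      assume "ennreal b + (\<Sum>k. ?a k) \<noteq> \<infinity>"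
      then obtain r where r: "ennreal b + (\<Sum>k. ?a k) = ennreal r" "r \<ge> 0"
        by (cases "ennreal b + (\<Sum>k. ?a k)") auto
      from unbounded[of r] obtain n where "r < 2 ^ n * b" by blast
      then show False using le[of n] r top b by simp
    qed
    then show ?thesis by simp
  qed
qed

text \<open>
  The levels below \<open>s\<close> form a geometric sequence, whose sum is less than twice its largest term. The
  induction needs the second bound \<open>2 ^ n * b\<close> on the sum of the first \<open>n\<close> layers as well.
\<close>

lemma dyadic_layers_le:
  fixes s :: ennreal
  assumes b: "b > 0"
  shows "(\<Sum>k. ennreal (2 ^ k * b) * indicator {ennreal (2 ^ k * b)<..} s) \<le> 2 * s"
proof -
  let ?a = "\<lambda>k. ennreal (2 ^ k * b) * indicator {ennreal (2 ^ k * b)<..} s"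
  have "(\<Sum>k<n. ?a k) \<le> min (2 * s) (ennreal (2 ^ n * b))" for n
  proof (induction n)
    case (Suc n)
    show ?case
    proof (cases "s \<le> ennreal (2 ^ n * b)")
      case True
      have "ennreal (2 ^ n * b) \<le> ennreal (2 ^ Suc n * b)" using b by (intro ennreal_leI) auto
      then have "min (2 * s) (ennreal (2 ^ n * b)) \<le> min (2 * s) (ennreal (2 ^ Suc n * b))"
        by (intro min.mono order_refl)
      moreover have "?a n = 0" using True by (simp add: not_less)
      ultimately show ?thesis using Suc by (simp only: sum.lessThan_Suc add_0_right)
    next
      case False
      have eq: "ennreal (2 ^ n * b) + ennreal (2 ^ n * b) = ennreal (2 ^ Suc n * b)"
        using b by (simp flip: ennreal_plus)
      have "(\<Sum>k<Suc n. ?a k) \<le> ennreal (2 ^ n * b) + ennreal (2 ^ n * b)"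
        using Suc False by (simp add: add_right_mono)
      moreover have "ennreal (2 ^ n * b) + ennreal (2 ^ n * b) \<le> 2 * s"
        using False by (simp add: mult_2 add_mono)
      ultimately show ?thesis unfolding eq by (intro min.boundedI) (rule order_trans)
    qed
  qed simp
  then show ?thesis by (intro suminf_le_const) auto
qed

text \<open>
  The number of powers \<open>2 ^ k\<close> below \<open>t\<close> is at least \<open>log_plus t\<close> and at most a multiple of
  \<open>1 + log_plus t\<close>. Weighting every layer of a function by the function itself therefore turns the two weak type inequalities into integrals of
  \<open>L log L\<close> type.
\<close>

lemma log_plus_le_layer_count:
  assumes "t \<ge> 0"
  shows "ennreal (log_plus t) \<le> (\<Sum>k. indicator {2 ^ k<..} t)"
proof -
  obtain m where "t < 2 ^ m" using real_arch_pow[of 2 t] by auto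
  then have ex: "\<exists>n. t \<le> 2 ^ n" by (auto intro: less_imp_le)
  define n where "n = (LEAST n. t \<le> 2 ^ n)"
  have n: "t \<le> 2 ^ n" unfolding n_def by (rule LeastI_ex[OF ex])
  have less: "2 ^ k < t" if "k < n" for k
    using not_less_Least[of k "\<lambda>n. t \<le> 2 ^ n"] that by (auto simp: n_def)
  have "log_plus t \<le> real n"
  proof (cases "t > 0")
    case True
    then have "ln t \<le> ln (2 ^ n)" using n by simp
    also have "\<dots> = real n * ln 2" by (simp add: ln_realpow)
    also have "\<dots> \<le> real n * 1" using ln_2_less_1 by (intro mult_left_mono) auto
    finally show ?thesis by (simp add: log_plus_def)
  next
    case False
    then have "t = 0" using assms by simp
    then show ?thesis by (simp add: log_plus_def)
  qed
  then have "ennreal (log_plus t) \<le> of_nat n" by (simp add: ennreal_leI flip: ennreal_of_nat_eq_real_of_nat)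
  also have "\<dots> = (\<Sum>k<n. indicator {2 ^ k<..} t)"
    using less by simp
  also have "\<dots> \<le> (\<Sum>k. indicator {2 ^ k<..} t)"
    by (intro sum_le_suminf) auto
  finally show ?thesis .
qed

lemma log_plus_nonneg: "log_plus t \<ge> 0"
  by (simp add: log_plus_def)

text \<open>
  The shift of the levels by a factor 2 comes from the truncation at \<open>t / 2\<close> in the weak type
  inequality.
\<close>

lemma layer_count_le_log_plus:
  "(\<Sum>k. indicator {2 ^ k / 2<..} t) \<le> ennreal (2 * (1 + log_plus t))"
proof -
  have "(\<Sum>k<n. indicator {2 ^ k / 2<..} t :: ennreal) \<le> ennreal (2 * (1 + log_plus t))" for n
  proof (induction n)
    case (Suc n)
    show ?case
    proof (cases "2 ^ n / 2 < t")
      case True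
      have "0 < (2 ^ n / 2 :: real)" by simp
      then have "ln (2 ^ n / 2) \<le> ln t" using True by (intro ln_mono) auto
      moreover have "ln (2 ^ n / 2 :: real) = (real n - 1) * ln 2"
        by (simp add: ln_div ln_realpow algebra_simps)
      moreover have "1 / 2 \<le> ln (2 :: real)" using ln2_ge_two_thirds by simp
      then have "(real n - 1) / 2 \<le> max ((real n - 1) * ln 2) 0"
      proof (cases "n = 0")
        case False
        then have "(real n - 1) * (1 / 2) \<le> (real n - 1) * ln 2"
          using \<open>1 / 2 \<le> ln 2\<close> by (intro mult_left_mono) auto
        then show ?thesis by simp
      qed simp
      ultimately have "real (Suc n) \<le> 2 * (1 + log_plus t)"
        by (auto simp: log_plus_def max_def split: if_splits)
      have "(\<Sum>k<Suc n. indicator {2 ^ k / 2<..} t) \<le> (\<Sum>k<Suc n. 1 :: ennreal)"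
        by (intro sum_mono) (simp add: indicator_def)
      also have "\<dots> = ennreal (real (Suc n))" by (simp add: ennreal_of_nat_eq_real_of_nat)
      also have "\<dots> \<le> ennreal (2 * (1 + log_plus t))"
        by (rule ennreal_leI) fact
      finally show ?thesis .
    next
      case False
      with Suc show ?thesis by simp
    qed
  qed (simp add: log_plus_nonneg)
  then show ?thesis by (intro suminf_le_const) auto
qed

section \<open>Local estimates\<close>

lemma measurable_log_plus [measurable]: "log_plus \<in> borel_measurable borel"
  unfolding log_plus_def[abs_def] by measurable

text \<open>
  Summing the weak type inequality over the levels \<open>2 ^ k * b\<close>: the part of the maximal function below
  \<open>b\<close> contributes at most \<open>b |Q|\<close>, and the layers above contribute a multiple of the integral of
  \<open>|f| (1 + log_plus (|f| / b))\<close>, which admissibility of \<open>b\<close> for the norm on \<open>3Q\<close> bounds by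
  \<open>b |3Q|\<close>.
\<close>

lemma integral_local_maximal_le:
  fixes f :: "real ^ 'n \<Rightarrow> real"
  defines "K \<equiv> 1 + 4 * (5 * real CARD('n)) ^ CARD('n) * 3 ^ CARD('n)"
  assumes f [measurable]: "f \<in> borel_measurable lebesgue" and b: "b > 0" and h: "h > 0"
    and adm: "(\<integral>\<^sup>+y\<in>cube c (3 * h). ennreal (\<bar>f y\<bar> / b * (1 + log_plus (\<bar>f y\<bar> / b))) \<partial>lebesgue)
      \<le> emeasure lebesgue (cube c (3 * h))"
  shows "(\<integral>\<^sup>+y\<in>cube c h. frac_maximal 0 (\<lambda>y. ennreal \<bar>f y\<bar> * indicator (cube c (3 * h)) y) y \<partial>lebesgue)
    \<le> ennreal (K * b) * emeasure lebesgue (cube c h)"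
proof -
  let ?T = "cube c (3 * h)" and ?Q = "cube c h" and ?D = "(5 * real CARD('n)) ^ CARD('n)"
  define G where "G = (\<lambda>y. ennreal \<bar>f y\<bar> * indicator ?T y)"
  define \<Phi> where "\<Phi> = (\<lambda>y. \<bar>f y\<bar> / b * (1 + log_plus (\<bar>f y\<bar> / b)))"
  have G [measurable]: "G \<in> borel_measurable lebesgue" unfolding G_def by measurable
  have Phi [measurable]: "\<Phi> \<in> borel_measurable lebesgue" unfolding \<Phi>_def by measurable
  have D: "?D > 0" by simp
  have adm': "(\<integral>\<^sup>+y. ennreal (\<Phi> y) * indicator ?T y \<partial>lebesgue) \<le> emeasure lebesgue ?T"
    using adm by (simp add: \<Phi>_def)
  have "(\<integral>\<^sup>+y. G y \<partial>lebesgue) \<le> (\<integral>\<^sup>+y. ennreal b * (ennreal (\<Phi> y) * indicator ?T y) \<partial>lebesgue)"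
  proof (intro nn_integral_mono)
    fix y
    have "\<bar>f y\<bar> \<le> b * \<Phi> y"
      using b log_plus_nonneg[of "\<bar>f y\<bar> / b"] by (simp add: \<Phi>_def mult_left_mono distrib_left)
    then show "G y \<le> ennreal b * (ennreal (\<Phi> y) * indicator ?T y)"
      using b by (simp add: G_def ennreal_mult'[symmetric] ennreal_leI split: split_indicator)
  qed
  also have "\<dots> \<le> ennreal b * emeasure lebesgue ?T"
    by (subst nn_integral_cmult) (auto intro!: mult_left_mono adm')
  also have "\<dots> < \<infinity>"
    by (simp add: emeasure_cube ennreal_mult_less_top)
  finally have finG: "(\<integral>\<^sup>+y. G y \<partial>lebesgue) \<noteq> \<infinity>" by simp
  let ?U = "\<lambda>k. {x. ennreal (2 ^ k * b) < frac_maximal 0 G x}"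
  let ?V = "\<lambda>k. {x. ennreal (2 ^ k * b / 2) < G x}"
  have U: "?U k \<in> sets lebesgue" for k by (rule sets_maximal_superlevel)
  have "(\<integral>\<^sup>+y\<in>?Q. frac_maximal 0 G y \<partial>lebesgue) \<le>
      (\<integral>\<^sup>+y. ennreal b * indicator ?Q y + (\<Sum>k. ennreal (2 ^ k * b) * indicator (?U k) y) \<partial>lebesgue)"
  proof (intro nn_integral_mono)
    fix y
    have "frac_maximal 0 G y \<le> ennreal b + (\<Sum>k. ennreal (2 ^ k * b) * indicator (?U k) y)"
      using dyadic_layers_ge[OF b, of "frac_maximal 0 G y"] by (simp add: indicator_def)
    then show "frac_maximal 0 G y * indicator ?Q y \<le>
        ennreal b * indicator ?Q y + (\<Sum>k. ennreal (2 ^ k * b) * indicator (?U k) y)"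
      by (simp split: split_indicator)
  qed
  also have "\<dots> = ennreal b * emeasure lebesgue ?Q + (\<Sum>k. ennreal (2 ^ k * b) * emeasure lebesgue (?U k))"
    using U by (simp add: nn_integral_add nn_integral_suminf nn_integral_cmult_indicator)
  finally have layers: "(\<integral>\<^sup>+y\<in>?Q. frac_maximal 0 G y \<partial>lebesgue) \<le>
    ennreal b * emeasure lebesgue ?Q + (\<Sum>k. ennreal (2 ^ k * b) * emeasure lebesgue (?U k))" .
  have "(\<Sum>k. ennreal (2 ^ k * b) * emeasure lebesgue (?U k)) \<le>
      (\<Sum>k. ennreal (2 * ?D) * (\<integral>\<^sup>+x. G x * indicator (?V k) x \<partial>lebesgue))"
  proof (intro suminf_le summableI)
    fix k :: nat
    let ?t = "2 ^ k * b"
    have t: "?t > 0" using b by simp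
    have "ennreal ?t * emeasure lebesgue (?U k) \<le>
        ennreal ?t * (ennreal (2 * ?D / ?t) * (\<integral>\<^sup>+x. G x * indicator (?V k) x \<partial>lebesgue))"
      by (intro mult_left_mono maximal_weak_type[OF G finG t]) simp
    also have "\<dots> = ennreal (?t * (2 * ?D / ?t)) * (\<integral>\<^sup>+x. G x * indicator (?V k) x \<partial>lebesgue)"
      using t D by (subst ennreal_mult) (auto simp: mult.assoc)
    also have "?t * (2 * ?D / ?t) = 2 * ?D" using t by (simp only: nonzero_mult_div_cancel_left times_divide_eq_right) 
    finally show "ennreal ?t * emeasure lebesgue (?U k) \<le>
        ennreal (2 * ?D) * (\<integral>\<^sup>+x. G x * indicator (?V k) x \<partial>lebesgue)" .
  qed
  also have "\<dots> = ennreal (2 * ?D) * (\<integral>\<^sup>+x. (\<Sum>k. G x * indicator (?V k) x) \<partial>lebesgue)"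
    by (subst nn_integral_suminf) auto
  finally have weak: "(\<Sum>k. ennreal (2 ^ k * b) * emeasure lebesgue (?U k)) \<le>
    ennreal (2 * ?D) * (\<integral>\<^sup>+x. (\<Sum>k. G x * indicator (?V k) x) \<partial>lebesgue)" .
  have "(\<integral>\<^sup>+x. (\<Sum>k. G x * indicator (?V k) x) \<partial>lebesgue) \<le>
      (\<integral>\<^sup>+x. ennreal (2 * b) * (ennreal (\<Phi> x) * indicator ?T x) \<partial>lebesgue)"
  proof (intro nn_integral_mono)
    fix x
    show "(\<Sum>k. G x * indicator (?V k) x) \<le> ennreal (2 * b) * (ennreal (\<Phi> x) * indicator ?T x)"
    proof (cases "x \<in> ?T")
      case True
      have "indicator (?V k) x = (indicator {2 ^ k / 2<..} (\<bar>f x\<bar> / b) :: ennreal)" for k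
        using True b by (simp add: G_def indicator_def ennreal_less_iff field_simps)
      then have "(\<Sum>k. G x * indicator (?V k) x) = G x * (\<Sum>k. indicator {2 ^ k / 2<..} (\<bar>f x\<bar> / b))"
        by simp
      also have "\<dots> \<le> ennreal \<bar>f x\<bar> * ennreal (2 * (1 + log_plus (\<bar>f x\<bar> / b)))"
        using True by (intro mult_mono layer_count_le_log_plus) (auto simp: G_def)
      also have "\<dots> = ennreal (2 * b * \<Phi> x)"
        using b log_plus_nonneg[of "\<bar>f x\<bar> / b"] by (subst ennreal_mult[symmetric]) (auto simp: \<Phi>_def)
      also have "\<dots> = ennreal (2 * b) * ennreal (\<Phi> x)"
        using b by (intro ennreal_mult') simp
      finally show ?thesis using True by simp
    qed (simp add: G_def)
  qed
  also have "\<dots> = ennreal (2 * b) * (\<integral>\<^sup>+x. ennreal (\<Phi> x) * indicator ?T x \<partial>lebesgue)"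
    by (rule nn_integral_cmult) measurable
  also have "\<dots> \<le> ennreal (2 * b) * emeasure lebesgue ?T"
    by (intro mult_left_mono adm') simp
  finally have "ennreal (2 * ?D) * (\<integral>\<^sup>+x. (\<Sum>k. G x * indicator (?V k) x) \<partial>lebesgue) \<le>
      ennreal (2 * ?D) * (ennreal (2 * b) * emeasure lebesgue ?T)"
    by (rule mult_left_mono) simp
  then have "(\<integral>\<^sup>+y\<in>?Q. frac_maximal 0 G y \<partial>lebesgue) \<le>
      ennreal b * emeasure lebesgue ?Q + ennreal (2 * ?D) * (ennreal (2 * b) * emeasure lebesgue ?T)"
    using layers weak by (meson add_left_mono order_trans)
  also have "\<dots> = ennreal (K * b * vol ?Q)"
  proof -
    define v where "v = vol ?Q"
    have v: "v > 0" using h by (simp add: v_def vol_cube_pos)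
    have T: "emeasure lebesgue ?T = ennreal (3 ^ CARD('n) * v)" "emeasure lebesgue ?Q = ennreal v"
      using h by (simp_all add: emeasure_cube v_def vol_cube_mult[of h 3 c c])
    have "ennreal b * ennreal v + ennreal (2 * ?D) * (ennreal (2 * b) * ennreal (3 ^ CARD('n) * v)) =
        ennreal (b * v + (2 * ?D) * ((2 * b) * (3 ^ CARD('n) * v)))"
      using b v by (simp only: ennreal_mult[symmetric] ennreal_plus[symmetric] D less_imp_le
          mult_nonneg_nonneg zero_le_numeral zero_le_power)
    also have "b * v + (2 * ?D) * ((2 * b) * (3 ^ CARD('n) * v)) = K * b * v"
      unfolding K_def by algebra
    finally show ?thesis unfolding T v_def[symmetric] .
  qed
  also have "\<dots> = ennreal (K * b) * emeasure lebesgue ?Q"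
    using b by (simp add: K_def emeasure_cube ennreal_mult)
  finally show ?thesis unfolding G_def .
qed

text \<open>
  Summing the reverse inequality over the levels \<open>2 ^ k * w\<close>, where \<open>w\<close> is the average of \<open>|f|\<close> over
  \<open>Q\<close>. Only levels \<open>t \<ge> w\<close> occur. For these, a cube on which \<open>|f|\<close> restricted to \<open>Q\<close> has average
  above \<open>t\<close> must be smaller than \<open>Q\<close> and must meet \<open>Q\<close>; hence all superlevel sets lie in \<open>3Q\<close>, and
  the sum of the layers stays below the integral of the maximal function over \<open>3Q\<close>.
\<close>

lemma integral_log_plus_le_maximal:
  fixes f :: "real ^ 'n \<Rightarrow> real"
  assumes f [measurable]: "f \<in> borel_measurable lebesgue" and w: "w > 0" and h: "h > 0"
    and avg: "(\<integral>\<^sup>+y\<in>cube c h. ennreal \<bar>f y\<bar> \<partial>lebesgue) = ennreal w * emeasure lebesgue (cube c h)"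
  shows "(\<integral>\<^sup>+y\<in>cube c h. ennreal (\<bar>f y\<bar> * log_plus (\<bar>f y\<bar> / w)) \<partial>lebesgue) \<le>
    ennreal (2 * (5 * real CARD('n)) ^ CARD('n)) *
      (\<integral>\<^sup>+y\<in>cube c (3 * h). frac_maximal 0 (\<lambda>y. ennreal \<bar>f y\<bar>) y \<partial>lebesgue)"
proof -
  let ?T = "cube c (3 * h)" and ?Q = "cube c h" and ?D = "(5 * real CARD('n)) ^ CARD('n)"
  let ?M = "frac_maximal 0 (\<lambda>y. ennreal \<bar>f y\<bar>)"
  define G where "G = (\<lambda>y. ennreal \<bar>f y\<bar> * indicator ?Q y)"
  have G [measurable]: "G \<in> borel_measurable lebesgue" unfolding G_def by measurable
  have intG: "(\<integral>\<^sup>+y. G y \<partial>lebesgue) = ennreal w * emeasure lebesgue ?Q"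
    using avg by (simp add: G_def)
  then have finG: "(\<integral>\<^sup>+y. G y \<partial>lebesgue) \<noteq> \<infinity>"
    by (simp add: emeasure_cube ennreal_mult_eq_top_iff)
  let ?U = "\<lambda>t. {x. ennreal t < frac_maximal 0 G x}"
  have U [measurable]: "?U t \<in> sets lebesgue" for t by (rule sets_maximal_superlevel)
  have inT: "x \<in> ?T" if x: "x \<in> ?U t" and t: "t \<ge> w" for x t
  proof -
    obtain c' h' where h': "h' > 0" "x \<in> cube c' h'"
        "ennreal t * emeasure lebesgue (cube c' h') < (\<integral>\<^sup>+y\<in>cube c' h'. G y \<partial>lebesgue)"
      using x less_frac_maximal_0_iff[of "ennreal t" G x] by auto
    have "\<exists>z. z \<in> cube c' h' \<and> z \<in> ?Q"
    proof (rule ccontr)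
      assume "\<nexists>z. z \<in> cube c' h' \<and> z \<in> ?Q"
      then have "G y * indicator (cube c' h') y = 0" for y
        by (auto simp: G_def split: split_indicator)
      then have "(\<integral>\<^sup>+y\<in>cube c' h'. G y \<partial>lebesgue) = 0" by (simp only: nn_integral_const mult_zero_left)
      then show False using h'(3) by simp
    qed
    then obtain z where z: "z \<in> cube c' h'" "z \<in> ?Q" by blast
    have "(\<integral>\<^sup>+y\<in>cube c' h'. G y \<partial>lebesgue) \<le> (\<integral>\<^sup>+y. G y \<partial>lebesgue)"
      by (intro nn_integral_mono) (auto split: split_indicator)
    with h'(3) have "ennreal t * emeasure lebesgue (cube c' h') < ennreal w * emeasure lebesgue ?Q"
      by (simp add: intG)
    also have "\<dots> \<le> ennreal t * emeasure lebesgue ?Q"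
      using t by (intro mult_right_mono ennreal_leI) auto
    finally have "t * (2 * h') ^ CARD('n) < t * (2 * h) ^ CARD('n)"
      using t w h h'(1) by (simp add: emeasure_cube vol_cube ennreal_mult[symmetric] ennreal_less_iff)
    then have "(2 * h') ^ CARD('n) < (2 * h) ^ CARD('n)" using t w by simp
    then have hh: "h' < h" using h by (auto dest: power_less_imp_less_base)
    have "\<bar>x $ i - c $ i\<bar> \<le> 3 * h" for i
    proof -
      have "\<bar>x $ i - c' $ i\<bar> \<le> h'" "\<bar>z $ i - c' $ i\<bar> \<le> h'" "\<bar>z $ i - c $ i\<bar> \<le> h"
        using h'(2) z by (auto simp: mem_cube)
      then show ?thesis using hh by linarith
    qed
    then show ?thesis by (simp add: mem_cube)
  qed
  have off: "AE x in lebesgue. ennreal t < G x \<longrightarrow> x \<in> ?U t" if t: "t > 0" for t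
  proof -
    let ?N = "{x \<in> ?Q. frac_maximal 0 G x \<le> ennreal t \<and> ennreal t < G x}"
    have "?N \<in> sets lebesgue" by measurable
    then have "?N \<in> null_sets lebesgue"
      using null_above_maximal[OF G t h, of c] by auto
    then show ?thesis
      by (rule AE_I') (auto simp: G_def not_less split: split_indicator_asm)
  qed
  have "(\<integral>\<^sup>+y\<in>?Q. ennreal (\<bar>f y\<bar> * log_plus (\<bar>f y\<bar> / w)) \<partial>lebesgue) \<le>
      (\<integral>\<^sup>+y. (\<Sum>k. G y * indicator {y. ennreal (2 ^ k * w) < G y} y) \<partial>lebesgue)"
  proof (intro nn_integral_mono)
    fix y
    show "ennreal (\<bar>f y\<bar> * log_plus (\<bar>f y\<bar> / w)) * indicator ?Q y \<le>
      (\<Sum>k. G y * indicator {y. ennreal (2 ^ k * w) < G y} y)"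
    proof (cases "y \<in> ?Q")
      case True
      have "indicator {y. ennreal (2 ^ k * w) < G y} y = (indicator {2 ^ k<..} (\<bar>f y\<bar> / w) :: ennreal)" for k
        using True w by (simp add: G_def indicator_def ennreal_less_iff field_simps)
      then have eq: "(\<Sum>k. G y * indicator {y. ennreal (2 ^ k * w) < G y} y) =
          ennreal \<bar>f y\<bar> * (\<Sum>k. indicator {2 ^ k<..} (\<bar>f y\<bar> / w))"
        using True by (simp add: G_def)
      show ?thesis
        unfolding eq using True w
        by (simp add: ennreal_mult log_plus_nonneg mult_left_mono log_plus_le_layer_count)
    qed (simp add: G_def)
  qed
  also have "\<dots> = (\<Sum>k. \<integral>\<^sup>+y. G y * indicator {y. ennreal (2 ^ k * w) < G y} y \<partial>lebesgue)"
    by (rule nn_integral_suminf) measurable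
  also have "\<dots> \<le> (\<Sum>k. \<integral>\<^sup>+y. ennreal ?D * (ennreal (2 ^ k * w) * indicator (?U (2 ^ k * w)) y) \<partial>lebesgue)"
  proof (intro suminf_le summableI)
    fix k :: nat
    have t: "2 ^ k * w > 0" using w by simp
    have "(\<integral>\<^sup>+y. G y * indicator {y. ennreal (2 ^ k * w) < G y} y \<partial>lebesgue) \<le>
        (\<integral>\<^sup>+y\<in>?U (2 ^ k * w). G y \<partial>lebesgue)"
      using off[OF t] by (intro nn_integral_mono_AE) (auto elim!: eventually_mono split: split_indicator)
    also have "\<dots> \<le> ennreal (?D * (2 ^ k * w)) * emeasure lebesgue (?U (2 ^ k * w))"
      by (rule maximal_reverse_weak_type[OF G finG t])
    also have "\<dots> = (\<integral>\<^sup>+y. ennreal ?D * (ennreal (2 ^ k * w) * indicator (?U (2 ^ k * w)) y) \<partial>lebesgue)"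
      using t by (simp add: nn_integral_cmult nn_integral_cmult_indicator ennreal_mult mult.assoc)
    finally show "(\<integral>\<^sup>+y. G y * indicator {y. ennreal (2 ^ k * w) < G y} y \<partial>lebesgue) \<le> \<dots>" .
  qed
  also have "\<dots> = (\<integral>\<^sup>+y. (\<Sum>k. ennreal ?D * (ennreal (2 ^ k * w) * indicator (?U (2 ^ k * w)) y)) \<partial>lebesgue)"
    by (rule nn_integral_suminf[symmetric]) measurable
  also have "\<dots> \<le> (\<integral>\<^sup>+y. ennreal (2 * ?D) * (?M y * indicator ?T y) \<partial>lebesgue)"
  proof (intro nn_integral_mono)
    fix y
    let ?S = "\<Sum>k. ennreal (2 ^ k * w) * indicator (?U (2 ^ k * w)) y"
    have "?S \<le> 2 * (?M y * indicator ?T y)"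
    proof (cases "y \<in> ?T")
      case True
      have "?S \<le> 2 * frac_maximal 0 G y"
        using dyadic_layers_le[OF w, of "frac_maximal 0 G y"] by (simp add: indicator_def)
      also have "frac_maximal 0 G y \<le> ?M y"
        unfolding frac_maximal_def
        by (intro SUP_mono' mult_left_mono nn_integral_mono) (auto simp: G_def split: split_indicator)
      finally show ?thesis using True by (simp add: mult_left_mono)
    next
      case False
      have "w \<le> 2 ^ k * w" for k using w by simp
      then have "y \<notin> ?U (2 ^ k * w)" for k using inT[of y "2 ^ k * w"] False by blast
      then have "?S = 0" by simp
      then show ?thesis by simp
    qed
    then have "ennreal ?D * ?S \<le> ennreal ?D * (2 * (?M y * indicator ?T y))"
      by (rule mult_left_mono) simp
    moreover have "ennreal (2 * ?D) = ennreal ?D * 2"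
      by (subst mult.commute) (simp add: ennreal_mult')
    ultimately show "(\<Sum>k. ennreal ?D * (ennreal (2 ^ k * w) * indicator (?U (2 ^ k * w)) y)) \<le>
        ennreal (2 * ?D) * (?M y * indicator ?T y)"
      by (simp only: ennreal_suminf_cmult mult.assoc)
  qed
  also have "\<dots> = ennreal (2 * ?D) * (\<integral>\<^sup>+y\<in>?T. ?M y \<partial>lebesgue)"
    by (rule nn_integral_cmult) measurable
  finally show ?thesis .
qed

section \<open>The L log L norm and the mean of the integrand\<close>

lemma locally_integrable_measurable:
  fixes f :: "real ^ 'n \<Rightarrow> real"
  assumes "locally_integrable f"
  shows "f \<in> borel_measurable lebesgue"
proof (rule borel_measurable_LIMSEQ_real)
  fix x :: "real ^ 'n"
  have "\<forall>\<^sub>F k in sequentially. indicator (cube 0 (real k)) x *\<^sub>R f x = f x"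
  proof (rule eventually_mono)
    show "\<forall>\<^sub>F k in sequentially. norm x \<le> real k"
      using filterlim_real_sequentially by (simp add: filterlim_at_top)
    fix k assume "norm x \<le> real k"
    then have "x \<in> cube 0 (real k)"
      using component_le_norm_cart[of x] by (auto simp: mem_cube intro: order_trans)
    then show "indicator (cube 0 (real k)) x *\<^sub>R f x = f x" by simp
  qed
  then show "(\<lambda>k. indicator (cube 0 (real k)) x *\<^sub>R f x) \<longlonglongrightarrow> f x"
    by (rule tendsto_eventually)
next
  fix k
  show "(\<lambda>x. indicator (cube 0 (real k)) x *\<^sub>R f x) \<in> borel_measurable lebesgue"
    using assms compact_cube unfolding locally_integrable_def set_integrable_def by blast
qed

lemma abs_avg_nonneg: "abs_avg f Q \<ge> 0"
  unfolding abs_avg_def set_lebesgue_integral_def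
  by (intro mult_nonneg_nonneg integral_nonneg_AE) auto

lemma nn_integral_eq_abs_avg:
  fixes f :: "real ^ 'n \<Rightarrow> real"
  assumes f: "locally_integrable f" and h: "h > 0"
  shows "(\<integral>\<^sup>+y\<in>cube c h. ennreal \<bar>f y\<bar> \<partial>lebesgue) = ennreal (abs_avg f (cube c h)) * emeasure lebesgue (cube c h)"
proof -
  have "set_integrable lebesgue (cube c h) (\<lambda>y. \<bar>f y\<bar>)"
    using f compact_cube unfolding locally_integrable_def by (intro set_integrable_abs) blast
  then have int: "integrable lebesgue (\<lambda>y. indicator (cube c h) y *\<^sub>R \<bar>f y\<bar>)"
    by (simp add: set_integrable_def)
  have "(\<integral>\<^sup>+y\<in>cube c h. ennreal \<bar>f y\<bar> \<partial>lebesgue) = (\<integral>\<^sup>+y. ennreal (indicator (cube c h) y *\<^sub>R \<bar>f y\<bar>) \<partial>lebesgue)"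
    by (intro nn_integral_cong) (auto split: split_indicator)
  also have "\<dots> = ennreal (LINT y:cube c h|lebesgue. \<bar>f y\<bar>)"
    using int unfolding set_lebesgue_integral_def by (rule nn_integral_eq_integral) auto
  also have "\<dots> = ennreal (abs_avg f (cube c h) * vol (cube c h))"
    using vol_cube_pos[OF h, of c] by (simp add: abs_avg_def)
  finally show ?thesis by (simp add: ennreal_mult abs_avg_nonneg emeasure_cube)
qed

lemma inverse_vol_mult_emeasure:
  "h > 0 \<Longrightarrow> ennreal (1 / vol (cube c h)) * (a * emeasure lebesgue (cube c h)) = a"
  using vol_cube_pos[of h c]
  by (simp add: emeasure_cube mult.left_commute[of _ a] ennreal_mult[symmetric])

text \<open>
  Every \<open>b\<close> admissible for the norm is at least the average, since \<open>t \<le> t (1 + log_plus t)\<close>.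
\<close>

lemma average_le_LlogL_norm:
  fixes f :: "real ^ 'n \<Rightarrow> real"
  assumes [measurable]: "f \<in> borel_measurable lebesgue"
  shows "ennreal (1 / vol (cube c h)) * (\<integral>\<^sup>+y\<in>cube c h. ennreal \<bar>f y\<bar> \<partial>lebesgue) \<le> LlogL_norm f (cube c h)"
  unfolding LlogL_norm_def
proof (rule Inf_greatest, clarify)
  fix b :: real assume b: "b > 0"
  define \<Phi> where "\<Phi> = (\<lambda>y. \<bar>f y\<bar> / b * (1 + log_plus (\<bar>f y\<bar> / b)))"
  assume "ennreal (1 / vol (cube c h)) * (\<integral>\<^sup>+y\<in>cube c h. ennreal (\<bar>f y\<bar> / b * (1 + log_plus (\<bar>f y\<bar> / b))) \<partial>lebesgue) \<le> 1"
  then have adm: "ennreal (1 / vol (cube c h)) * (\<integral>\<^sup>+y\<in>cube c h. ennreal (\<Phi> y) \<partial>lebesgue) \<le> 1"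
    by (simp add: \<Phi>_def)
  have [measurable]: "\<Phi> \<in> borel_measurable lebesgue" unfolding \<Phi>_def by measurable
  have "(\<integral>\<^sup>+y\<in>cube c h. ennreal \<bar>f y\<bar> \<partial>lebesgue) \<le>
      (\<integral>\<^sup>+y. ennreal b * (ennreal (\<Phi> y) * indicator (cube c h) y) \<partial>lebesgue)"
  proof (intro nn_integral_mono)
    fix y
    have "\<bar>f y\<bar> \<le> b * \<Phi> y"
      using b log_plus_nonneg[of "\<bar>f y\<bar> / b"] by (simp add: \<Phi>_def mult_left_mono distrib_left)
    then show "ennreal \<bar>f y\<bar> * indicator (cube c h) y \<le> ennreal b * (ennreal (\<Phi> y) * indicator (cube c h) y)"
      using b by (simp add: ennreal_mult'[symmetric] ennreal_leI split: split_indicator)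
  qed
  also have "\<dots> = ennreal b * (\<integral>\<^sup>+y\<in>cube c h. ennreal (\<Phi> y) \<partial>lebesgue)"
    by (rule nn_integral_cmult) measurable
  finally have "ennreal (1 / vol (cube c h)) * (\<integral>\<^sup>+y\<in>cube c h. ennreal \<bar>f y\<bar> \<partial>lebesgue) \<le>
      ennreal b * (ennreal (1 / vol (cube c h)) * (\<integral>\<^sup>+y\<in>cube c h. ennreal (\<Phi> y) \<partial>lebesgue))"
    unfolding mult.left_commute[of "ennreal b"] by (rule mult_left_mono) simp
  also have "\<dots> \<le> ennreal b * 1"
    using adm by (rule mult_left_mono) simp
  finally show "ennreal (1 / vol (cube c h)) * (\<integral>\<^sup>+y\<in>cube c h. ennreal \<bar>f y\<bar> \<partial>lebesgue) \<le> ennreal b"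
    by simp
qed

lemma LlogL_integrand_nonneg: "LlogL_integrand f Q y \<ge> 0"
  by (simp add: LlogL_integrand_def log_plus_nonneg)

lemma measurable_LlogL_integrand [measurable]:
  assumes [measurable]: "f \<in> borel_measurable lebesgue"
  shows "LlogL_integrand f Q \<in> borel_measurable lebesgue"
  unfolding LlogL_integrand_def[abs_def] by (cases "abs_avg f Q = 0") simp_all

text \<open>
  If the mean is positive and finite, it is an admissible value of \<open>b\<close>: it is at least the average of \<open>|f|\<close>, so replacing
  that average by the mean inside the logarithm decreases the integrand. If the average vanishes, so
  does \<open>f\<close> almost everywhere on the cube, and every positive \<open>b\<close> is admissible.
\<close>

lemma LlogL_norm_le_mean:
  fixes f :: "real ^ 'n \<Rightarrow> real"
  assumes f: "locally_integrable f" and h: "h > 0"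
  shows "LlogL_norm f (cube c h) \<le>
    ennreal (1 / vol (cube c h)) * (\<integral>\<^sup>+y\<in>cube c h. ennreal (LlogL_integrand f (cube c h) y) \<partial>lebesgue)"
proof -
  let ?Q = "cube c h" and ?w = "abs_avg f (cube c h)"
  define v where "v = vol (cube c h)"
  have v: "v > 0" using h by (simp add: v_def vol_cube_pos)
  define I where "I = ennreal (1 / v) * (\<integral>\<^sup>+y\<in>?Q. ennreal (LlogL_integrand f ?Q y) \<partial>lebesgue)"
  have [measurable]: "f \<in> borel_measurable lebesgue" by (rule locally_integrable_measurable[OF f])
  have "LlogL_norm f ?Q \<le> I"
  proof (cases "?w = 0")
    case True
    then have "(\<integral>\<^sup>+y\<in>?Q. ennreal \<bar>f y\<bar> \<partial>lebesgue) = 0"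
      using nn_integral_eq_abs_avg[OF f h] by simp
    then have AE0: "AE y in lebesgue. ennreal \<bar>f y\<bar> * indicator ?Q y = 0"
      by (subst (asm) nn_integral_0_iff_AE) auto
    have adm: "(\<integral>\<^sup>+y\<in>?Q. ennreal (\<bar>f y\<bar> / b * (1 + log_plus (\<bar>f y\<bar> / b))) \<partial>lebesgue) = 0" for b
      using AE0 by (subst nn_integral_0_iff_AE) (auto elim!: eventually_mono split: split_indicator)
    have "LlogL_norm f ?Q \<le> 0 + ennreal b" if "b > 0" for b
      unfolding LlogL_norm_def using that adm by (intro Inf_lower) (auto intro!: exI[of _ b])
    then have "LlogL_norm f ?Q \<le> 0" by (rule ennreal_le_epsilon) auto
    then show ?thesis by simp
  next
    case False
    then have w: "?w > 0" using abs_avg_nonneg[of f ?Q] by simp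
    show ?thesis
    proof (cases "I = \<infinity>")
      case True
      then show ?thesis by simp
    next
      case False
      then obtain b where b: "I = ennreal b" "b \<ge> 0" by (cases I) auto
      have "ennreal ?w = ennreal (1 / v) * (\<integral>\<^sup>+y\<in>?Q. ennreal \<bar>f y\<bar> \<partial>lebesgue)"
        unfolding nn_integral_eq_abs_avg[OF f h] v_def inverse_vol_mult_emeasure[OF h] ..
      also have "\<dots> \<le> I"
        unfolding I_def using w
        by (intro mult_left_mono nn_integral_mono)
          (auto simp: LlogL_integrand_def log_plus_nonneg distrib_left intro!: ennreal_leI split: split_indicator)
      finally have wb: "?w \<le> b" using b by simp
      have "ennreal (1 / v) * (\<integral>\<^sup>+y\<in>?Q. ennreal (\<bar>f y\<bar> / b * (1 + log_plus (\<bar>f y\<bar> / b))) \<partial>lebesgue) \<le>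
          ennreal (1 / v) * (\<integral>\<^sup>+y. ennreal (1 / b) * (ennreal (LlogL_integrand f ?Q y) * indicator ?Q y) \<partial>lebesgue)"
      proof (intro mult_left_mono nn_integral_mono)
        fix y
        have "\<bar>f y\<bar> / b \<le> \<bar>f y\<bar> / ?w" using wb w by (intro divide_left_mono) auto
        then have "log_plus (\<bar>f y\<bar> / b) \<le> log_plus (\<bar>f y\<bar> / ?w)"
          using wb w by (cases "f y = 0") (auto simp: log_plus_def intro!: max.coboundedI1 ln_mono)
        then have "\<bar>f y\<bar> * (1 + log_plus (\<bar>f y\<bar> / b)) \<le> \<bar>f y\<bar> * (1 + log_plus (\<bar>f y\<bar> / ?w))"
          by (intro mult_left_mono) auto
        then have "\<bar>f y\<bar> / b * (1 + log_plus (\<bar>f y\<bar> / b)) \<le> 1 / b * LlogL_integrand f ?Q y"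
          using w wb by (simp add: LlogL_integrand_def divide_right_mono)
        then have "ennreal (\<bar>f y\<bar> / b * (1 + log_plus (\<bar>f y\<bar> / b))) \<le> ennreal (1 / b) * ennreal (LlogL_integrand f ?Q y)"
          using w wb by (subst ennreal_mult[symmetric]) (auto simp: LlogL_integrand_nonneg intro!: ennreal_leI)
        then show "ennreal (\<bar>f y\<bar> / b * (1 + log_plus (\<bar>f y\<bar> / b))) * indicator ?Q y \<le>
            ennreal (1 / b) * (ennreal (LlogL_integrand f ?Q y) * indicator ?Q y)"
          by (auto split: split_indicator)
      qed auto
      also have "\<dots> = ennreal (1 / b) * I"
        unfolding I_def by (subst nn_integral_cmult) (auto simp: mult.left_commute)
      also have "\<dots> = 1"
        using b w wb by (simp add: ennreal_mult[symmetric])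
      finally show ?thesis
        unfolding LlogL_norm_def using b w wb v_def by (intro Inf_lower) auto
    qed
  qed
  then show ?thesis by (simp add: I_def v_def)
qed

text \<open>
  For admissible \<open>b\<close> and average \<open>w \<le> b\<close>, the logarithm of \<open>|f| / w\<close> exceeds that of \<open>|f| / b\<close> by
  \<open>ln (b / w) \<le> b / w\<close>. After averaging, this excess costs at most \<open>w * (b / w) = b\<close>, and the main
  term is at most \<open>b\<close> by admissibility.
\<close>

lemma mean_le_LlogL_norm:
  fixes f :: "real ^ 'n \<Rightarrow> real"
  assumes f: "locally_integrable f" and h: "h > 0"
  shows "ennreal (1 / vol (cube c h)) * (\<integral>\<^sup>+y\<in>cube c h. ennreal (LlogL_integrand f (cube c h) y) \<partial>lebesgue)
    \<le> 2 * LlogL_norm f (cube c h)"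
proof -
  let ?Q = "cube c h" and ?w = "abs_avg f (cube c h)"
  define v where "v = vol (cube c h)"
  have v: "v > 0" using h by (simp add: v_def vol_cube_pos)
  have [measurable]: "f \<in> borel_measurable lebesgue" by (rule locally_integrable_measurable[OF f])
  define I where "I = ennreal (1 / v) * (\<integral>\<^sup>+y\<in>?Q. ennreal (LlogL_integrand f ?Q y) \<partial>lebesgue)"
  have avg: "ennreal (1 / v) * (\<integral>\<^sup>+y\<in>?Q. ennreal \<bar>f y\<bar> \<partial>lebesgue) = ennreal ?w"
    unfolding nn_integral_eq_abs_avg[OF f h] v_def inverse_vol_mult_emeasure[OF h] ..
  have "I / 2 \<le> LlogL_norm f ?Q"
    unfolding LlogL_norm_def
  proof (rule Inf_greatest, clarify)
    fix b :: real assume b: "b > 0"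
    define \<Phi> where "\<Phi> = (\<lambda>y. \<bar>f y\<bar> / b * (1 + log_plus (\<bar>f y\<bar> / b)))"
    have [measurable]: "\<Phi> \<in> borel_measurable lebesgue" unfolding \<Phi>_def by measurable
    assume adm: "ennreal (1 / vol ?Q) * (\<integral>\<^sup>+y\<in>?Q. ennreal (\<bar>f y\<bar> / b * (1 + log_plus (\<bar>f y\<bar> / b))) \<partial>lebesgue) \<le> 1"
    then have adm': "ennreal (1 / v) * (\<integral>\<^sup>+y\<in>?Q. ennreal (\<Phi> y) \<partial>lebesgue) \<le> 1"
      by (simp add: \<Phi>_def v_def)
    have "LlogL_norm f ?Q \<le> ennreal b"
      unfolding LlogL_norm_def using b adm by (intro Inf_lower) auto
    then have wb: "?w \<le> b"
      using average_le_LlogL_norm[of f c h] avg b by (simp add: v_def) (meson ennreal_le_iff order_trans less_imp_le)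
    have "I \<le> ennreal (2 * b)"
    proof (cases "?w = 0")
      case True
      then show ?thesis by (simp add: I_def LlogL_integrand_def)
    next
      case False
      then have w: "?w > 0" using abs_avg_nonneg[of f ?Q] by simp
      have pointwise: "LlogL_integrand f ?Q y \<le> b * \<Phi> y + b / ?w * \<bar>f y\<bar>" for y
      proof (cases "f y = 0")
        case True
        then show ?thesis by (simp add: LlogL_integrand_def \<Phi>_def)
      next
        case False
        then have f0: "\<bar>f y\<bar> > 0" by simp
        have "ln (\<bar>f y\<bar> / ?w) = ln (\<bar>f y\<bar> / b) + ln (b / ?w)"
          using f0 b w by (simp add: ln_div)
        moreover have "ln (b / ?w) \<le> b / ?w" using b w ln_le_minus_one[of "b / ?w"] by simp
        moreover have "0 \<le> b / ?w" using b w by simp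
        ultimately have "log_plus (\<bar>f y\<bar> / ?w) \<le> log_plus (\<bar>f y\<bar> / b) + b / ?w"
          unfolding log_plus_def by linarith
        then have "\<bar>f y\<bar> * (1 + log_plus (\<bar>f y\<bar> / ?w)) \<le> \<bar>f y\<bar> * (1 + log_plus (\<bar>f y\<bar> / b) + b / ?w)"
          by (intro mult_left_mono) auto
        also have "\<dots> = b * \<Phi> y + b / ?w * \<bar>f y\<bar>"
          using b by (simp add: \<Phi>_def algebra_simps)
        finally show ?thesis using w by (simp add: LlogL_integrand_def)
      qed
      have Phi0: "\<Phi> y \<ge> 0" for y using b by (simp add: \<Phi>_def log_plus_nonneg)
      have "(\<integral>\<^sup>+y\<in>?Q. ennreal (LlogL_integrand f ?Q y) \<partial>lebesgue) \<le>
          (\<integral>\<^sup>+y. ennreal b * (ennreal (\<Phi> y) * indicator ?Q y) + ennreal (b / ?w) * (ennreal \<bar>f y\<bar> * indicator ?Q y) \<partial>lebesgue)"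
      proof (intro nn_integral_mono)
        fix y
        have "ennreal (LlogL_integrand f ?Q y) \<le> ennreal (b * \<Phi> y + b / ?w * \<bar>f y\<bar>)"
          by (rule ennreal_leI[OF pointwise])
        also have "\<dots> = ennreal b * ennreal (\<Phi> y) + ennreal (b / ?w) * ennreal \<bar>f y\<bar>"
          using b w Phi0[of y] by (simp add: ennreal_mult[symmetric] ennreal_plus[symmetric] del: ennreal_plus)
        finally show "ennreal (LlogL_integrand f ?Q y) * indicator ?Q y \<le>
            ennreal b * (ennreal (\<Phi> y) * indicator ?Q y) + ennreal (b / ?w) * (ennreal \<bar>f y\<bar> * indicator ?Q y)"
          by (auto split: split_indicator)
      qed
      also have "\<dots> = ennreal b * (\<integral>\<^sup>+y\<in>?Q. ennreal (\<Phi> y) \<partial>lebesgue) + ennreal (b / ?w) * (\<integral>\<^sup>+y\<in>?Q. ennreal \<bar>f y\<bar> \<partial>lebesgue)"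
        by (subst nn_integral_add) (auto simp: nn_integral_cmult)
      finally have "I \<le> ennreal (1 / v) * (ennreal b * (\<integral>\<^sup>+y\<in>?Q. ennreal (\<Phi> y) \<partial>lebesgue) + ennreal (b / ?w) * (\<integral>\<^sup>+y\<in>?Q. ennreal \<bar>f y\<bar> \<partial>lebesgue))"
        unfolding I_def by (rule mult_left_mono) simp
      also have "\<dots> = ennreal b * (ennreal (1 / v) * (\<integral>\<^sup>+y\<in>?Q. ennreal (\<Phi> y) \<partial>lebesgue)) +
          ennreal (b / ?w) * (ennreal (1 / v) * (\<integral>\<^sup>+y\<in>?Q. ennreal \<bar>f y\<bar> \<partial>lebesgue))"
        by (simp only: distrib_left mult.left_commute)
      also have "\<dots> \<le> ennreal b * 1 + ennreal (b / ?w) * ennreal ?w"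
        unfolding avg by (intro add_right_mono mult_left_mono adm') simp
      also have "\<dots> = ennreal (2 * b)"
        using b w by (simp add: ennreal_mult[symmetric] ennreal_plus[symmetric] del: ennreal_plus)
      finally show ?thesis .
    qed
    then have "I / 2 \<le> ennreal (2 * b) / 2" by (rule divide_right_mono_ennreal)
    also have "\<dots> = ennreal b" using b by (simp add: ennreal_divide_numeral)
    finally show "I / 2 \<le> ennreal b" .
  qed
  then have "2 * (I / 2) \<le> 2 * LlogL_norm f ?Q" by (rule mult_left_mono) simp
  moreover have "2 * (I / 2) = I"
    by (simp add: ennreal_times_divide mult.commute[of 2] mult_divide_eq_ennreal)
  ultimately show ?thesis by (simp add: I_def v_def)
qed

section \<open>Comparison of the suprema\<close>

lemma SUP_cubes_at_le:
  assumes "\<And>c h. h > 0 \<Longrightarrow> x \<in> cube c h \<Longrightarrow> F (cube c h) \<le> (b :: ennreal)"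
  shows "(SUP Q\<in>cubes_at x. F Q) \<le> b"
  using assms by (intro SUP_least) (auto simp: cubes_at_iff)

lemma le_SUP_cubes_at:
  assumes "h > 0" "x \<in> cube c h"
  shows "(F (cube c h) :: ennreal) \<le> (SUP Q\<in>cubes_at x. F Q)"
  using assms by (intro SUP_upper) (auto simp: cubes_at_iff)

lemma scale_vol_powr:
  assumes "h > 0"
  shows "ennreal (vol (cube (c :: real ^ 'n) h) powr ((\<alpha> - real CARD('n)) / real CARD('n))) * I =
    ennreal (vol (cube c h) powr (\<alpha> / real CARD('n))) * (ennreal (1 / vol (cube c h)) * I)"
proof -
  have v: "vol (cube c h) > 0" using assms by (rule vol_cube_pos)
  then have "vol (cube c h) powr ((\<alpha> - real CARD('n)) / real CARD('n)) =
      vol (cube c h) powr (\<alpha> / real CARD('n)) * (1 / vol (cube c h))"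
    by (simp add: diff_divide_distrib powr_diff)
  then show ?thesis
    using v by (simp only: mult.assoc[symmetric]) (subst ennreal_mult, auto)
qed

lemma inverse_vol_dilate:
  assumes "h > 0"
  shows "ennreal (1 / vol (cube (c :: real ^ 'n) h)) = ennreal (3 ^ CARD('n)) * ennreal (1 / vol (cube c (3 * h)))"
  using vol_cube_pos[OF assms, of c]
  by (subst ennreal_mult[symmetric]) (auto simp: vol_cube_mult[OF assms, of 3 c c])

lemma vol_powr_mono:
  fixes c c' :: "real ^ 'n"
  assumes "0 \<le> \<alpha>" "0 < h" "h \<le> h'"
  shows "ennreal (vol (cube c h) powr (\<alpha> / real CARD('n))) \<le> ennreal (vol (cube c' h') powr (\<alpha> / real CARD('n)))"
  using assms by (intro ennreal_leI powr_mono2) (auto simp: vol_cube intro!: power_mono)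

text \<open>
  A cube \<open>R\<close> through a point of \<open>Q\<close> either lies in \<open>3Q\<close>, and then it only sees the restriction of
  \<open>f\<close> to \<open>3Q\<close>, or it is larger than \<open>Q\<close>. In the second case \<open>3R\<close> contains \<open>x\<close>, so that its norm
  takes part in the supremum at \<open>x\<close>; passing from \<open>R\<close> to \<open>3R\<close> costs the factor \<open>3 ^ CARD('n)\<close> in
  the average, and the factor \<open>vol Q powr (\<alpha> / CARD('n))\<close> only grows because \<open>\<alpha> \<ge> 0\<close>.
\<close>

lemma maximal_le_local_plus_far:
  fixes f :: "real ^ 'n \<Rightarrow> real"
  assumes f: "f \<in> borel_measurable lebesgue" and \<alpha>: "0 \<le> \<alpha>"
    and h: "h > 0" and x: "x \<in> cube c h" and y: "y \<in> cube c h"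
  shows "ennreal (vol (cube c h) powr (\<alpha> / real CARD('n))) * frac_maximal 0 (\<lambda>y. ennreal \<bar>f y\<bar>) y \<le>
    ennreal (vol (cube c h) powr (\<alpha> / real CARD('n))) *
      frac_maximal 0 (\<lambda>y. ennreal \<bar>f y\<bar> * indicator (cube c (3 * h)) y) y +
    ennreal (3 ^ CARD('n)) *
      (SUP Q\<in>cubes_at x. ennreal (vol Q powr (\<alpha> / real CARD('n))) * LlogL_norm f Q)"
    (is "ennreal ?p * _ \<le> ennreal ?p * ?ML + _ * ?B")
proof -
  let ?T = "cube c (3 * h)"
  let ?F = "\<lambda>R. ennreal (vol R powr ((0 - real CARD('n)) / real CARD('n))) * (\<integral>\<^sup>+y\<in>R. ennreal \<bar>f y\<bar> \<partial>lebesgue)"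
  have "ennreal ?p * ?F (cube c' h') \<le> ennreal ?p * ?ML + ennreal (3 ^ CARD('n)) * ?B"
    if h': "h' > 0" and yR: "y \<in> cube c' h'" for c' h'
  proof -
    let ?R = "cube c' h'" and ?R' = "cube c' (3 * h')"
    let ?I = "\<integral>\<^sup>+y\<in>?R. ennreal \<bar>f y\<bar> \<partial>lebesgue"
    have F: "?F ?R = ennreal (1 / vol ?R) * ?I"
      using vol_cube_pos[OF h', of c'] by (subst scale_vol_powr[OF h']) simp
    show ?thesis
    proof (cases "?R \<subseteq> ?T")
      case True
      have "?I = (\<integral>\<^sup>+y\<in>?R. (ennreal \<bar>f y\<bar> * indicator ?T y) \<partial>lebesgue)"
        using True by (intro nn_integral_cong) (auto split: split_indicator)
      then have "?F ?R \<le> ?ML"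
        unfolding F using average_le_maximal[OF h' yR] by simp
      then have "ennreal ?p * ?F ?R \<le> ennreal ?p * ?ML" by (rule mult_left_mono) simp
      then show ?thesis by (rule add_increasing2[rotated]) simp
    next
      case False
      then obtain z where z: "z \<in> ?R" "z \<notin> ?T" by blast
      then obtain i where i: "\<bar>z $ i - c $ i\<bar> > 3 * h" by (auto simp: mem_cube not_le)
      have "\<bar>z $ i - c' $ i\<bar> \<le> h'" "\<bar>y $ i - c' $ i\<bar> \<le> h'" "\<bar>y $ i - c $ i\<bar> \<le> h"
        using z yR y by (auto simp: mem_cube)
      with i have hh: "h \<le> h'" by linarith
      have "\<bar>x $ j - c' $ j\<bar> \<le> 3 * h'" for j
      proof -
        have "\<bar>x $ j - c $ j\<bar> \<le> h" "\<bar>y $ j - c $ j\<bar> \<le> h" "\<bar>y $ j - c' $ j\<bar> \<le> h'"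
          using x y yR by (auto simp: mem_cube)
        then show ?thesis using hh by linarith
      qed
      then have xR': "x \<in> ?R'" by (simp add: mem_cube)
      have h3: "3 * h' > 0" using h' by simp
      have sub: "?R \<subseteq> ?R'" using h' by (intro cube_mono) simp
      have "?F ?R = ennreal (3 ^ CARD('n)) * (ennreal (1 / vol ?R') * ?I)"
        unfolding F inverse_vol_dilate[OF h'] by (rule mult.assoc)
      also have "\<dots> \<le> ennreal (3 ^ CARD('n)) * (ennreal (1 / vol ?R') * (\<integral>\<^sup>+y\<in>?R'. ennreal \<bar>f y\<bar> \<partial>lebesgue))"
        using sub by (intro mult_left_mono nn_integral_mono) (auto split: split_indicator)
      also have "\<dots> \<le> ennreal (3 ^ CARD('n)) * LlogL_norm f ?R'"
        by (intro mult_left_mono average_le_LlogL_norm f) simp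
      finally have le: "?F ?R \<le> ennreal (3 ^ CARD('n)) * LlogL_norm f ?R'" .
      have "ennreal ?p * ?F ?R \<le> ennreal (vol ?R' powr (\<alpha> / real CARD('n))) * (ennreal (3 ^ CARD('n)) * LlogL_norm f ?R')"
        by (rule mult_mono[OF vol_powr_mono[OF \<alpha> h] le]) (use hh h' in auto)
      also have "\<dots> = ennreal (3 ^ CARD('n)) * (ennreal (vol ?R' powr (\<alpha> / real CARD('n))) * LlogL_norm f ?R')"
        by (rule mult.left_commute)
      also have "\<dots> \<le> ennreal (3 ^ CARD('n)) * ?B"
        by (intro mult_left_mono le_SUP_cubes_at[OF h3 xR']) simp
      finally show ?thesis by (rule add_increasing[rotated]) simp
    qed
  qed
  then have "(SUP R\<in>cubes_at y. ennreal ?p * ?F R) \<le> ennreal ?p * ?ML + ennreal (3 ^ CARD('n)) * ?B"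
    by (rule SUP_cubes_at_le)
  moreover have "ennreal ?p * frac_maximal 0 (\<lambda>y. ennreal \<bar>f y\<bar>) y = (SUP R\<in>cubes_at y. ennreal ?p * ?F R)"
    unfolding frac_maximal_def by (rule SUP_mult_left_ennreal)
  ultimately show ?thesis by simp
qed

text \<open>
  On each cube the maximal function is split into its local part, controlled by the norm on \<open>3Q\<close>, and
  the far part, which is bounded on \<open>Q\<close> by a constant.
\<close>

lemma frac_maximal_HL_le_LlogL_norm:
  fixes f :: "real ^ 'n \<Rightarrow> real"
  defines "K \<equiv> 1 + 4 * (5 * real CARD('n)) ^ CARD('n) * 3 ^ CARD('n)"
  assumes f: "locally_integrable f" and \<alpha>: "0 \<le> \<alpha>"
  shows "frac_maximal \<alpha> (HL_maximal f) x \<le> ennreal (K + 3 ^ CARD('n)) *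
    (SUP Q\<in>cubes_at x. ennreal (vol Q powr (\<alpha> / real CARD('n))) * LlogL_norm f Q)"
    (is "_ \<le> _ * ?B")
  unfolding frac_maximal_def[of \<alpha>]
proof (rule SUP_cubes_at_le)
  fix c :: "real ^ 'n" and h :: real
  assume h: "h > 0" and x: "x \<in> cube c h"
  have fm: "f \<in> borel_measurable lebesgue" by (rule locally_integrable_measurable[OF f])
  let ?Q = "cube c h" and ?T = "cube c (3 * h)"
  have h3: "3 * h > 0" and xT: "x \<in> ?T" using h x cube_mono[of h "3 * h" c] by auto
  let ?F1 = "frac_maximal 0 (\<lambda>y. ennreal \<bar>f y\<bar> * indicator ?T y)"
  define p where "p = vol ?Q powr (\<alpha> / real CARD('n))"
  define r where "r = ennreal (1 / vol ?Q)"
  have K: "K > 0" by (simp add: K_def add_pos_nonneg)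
  have loc: "r * (\<integral>\<^sup>+y\<in>?Q. ?F1 y \<partial>lebesgue) \<le> ennreal K * LlogL_norm f ?T"
  proof -
    have "r * (\<integral>\<^sup>+y\<in>?Q. ?F1 y \<partial>lebesgue) / ennreal K \<le> LlogL_norm f ?T"
      unfolding LlogL_norm_def
    proof (rule Inf_greatest, clarify)
      fix b :: real assume b: "b > 0"
      let ?J = "\<integral>\<^sup>+y\<in>?T. ennreal (\<bar>f y\<bar> / b * (1 + log_plus (\<bar>f y\<bar> / b))) \<partial>lebesgue"
      assume adm: "ennreal (1 / vol ?T) * ?J \<le> 1"
      have "?J = emeasure lebesgue ?T * (ennreal (1 / vol ?T) * ?J)"
        using vol_cube_pos[OF h3, of c]
        by (simp add: emeasure_cube mult.assoc[symmetric] ennreal_mult[symmetric])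
      also have "\<dots> \<le> emeasure lebesgue ?T * 1" by (rule mult_left_mono[OF adm]) simp
      finally have "(\<integral>\<^sup>+y\<in>?Q. ?F1 y \<partial>lebesgue) \<le> ennreal (K * b) * emeasure lebesgue ?Q"
        unfolding K_def using integral_local_maximal_le[OF fm b h] by simp
      then have "r * (\<integral>\<^sup>+y\<in>?Q. ?F1 y \<partial>lebesgue) \<le> r * (ennreal (K * b) * emeasure lebesgue ?Q)"
        by (rule mult_left_mono) simp
      also have "\<dots> = ennreal (K * b)" unfolding r_def by (rule inverse_vol_mult_emeasure[OF h])
      also have "\<dots> = ennreal b * ennreal K" using K b by (simp add: ennreal_mult mult.commute)
      finally have "r * (\<integral>\<^sup>+y\<in>?Q. ?F1 y \<partial>lebesgue) / ennreal K \<le> ennreal b * ennreal K / ennreal K"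
        by (rule divide_right_mono_ennreal)
      also have "\<dots> = ennreal b" using K by (intro mult_divide_eq_ennreal) auto
      finally show "r * (\<integral>\<^sup>+y\<in>?Q. ?F1 y \<partial>lebesgue) / ennreal K \<le> ennreal b" .
    qed
    then have "ennreal K * (r * (\<integral>\<^sup>+y\<in>?Q. ?F1 y \<partial>lebesgue) / ennreal K) \<le> ennreal K * LlogL_norm f ?T"
      by (rule mult_left_mono) simp
    moreover have "ennreal K * (r * (\<integral>\<^sup>+y\<in>?Q. ?F1 y \<partial>lebesgue) / ennreal K) = r * (\<integral>\<^sup>+y\<in>?Q. ?F1 y \<partial>lebesgue)"
      using K unfolding ennreal_times_divide mult.commute[of "ennreal K"] by (intro mult_divide_eq_ennreal) auto
    ultimately show ?thesis by simp
  qed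
  have HLm [measurable]: "HL_maximal f \<in> borel_measurable lebesgue"
    unfolding HL_maximal_def by measurable
  have "ennreal (vol ?Q powr ((\<alpha> - real CARD('n)) / real CARD('n))) * (\<integral>\<^sup>+y\<in>?Q. HL_maximal f y \<partial>lebesgue)
      = r * (\<integral>\<^sup>+y. ennreal p * (HL_maximal f y * indicator ?Q y) \<partial>lebesgue)"
    unfolding scale_vol_powr[OF h] r_def p_def by (subst nn_integral_cmult) (auto simp: mult.left_commute)
  also have "\<dots> \<le> r * (\<integral>\<^sup>+y. ennreal p * (?F1 y * indicator ?Q y) + ennreal (3 ^ CARD('n)) * ?B * indicator ?Q y \<partial>lebesgue)"
  proof (intro mult_left_mono nn_integral_mono)
    fix y
    show "ennreal p * (HL_maximal f y * indicator ?Q y) \<le>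
        ennreal p * (?F1 y * indicator ?Q y) + ennreal (3 ^ CARD('n)) * ?B * indicator ?Q y"
      using maximal_le_local_plus_far[OF fm \<alpha> h x, of y]
      by (simp add: p_def HL_maximal_def split: split_indicator)
  qed simp
  also have "\<dots> = r * (ennreal p * (\<integral>\<^sup>+y\<in>?Q. ?F1 y \<partial>lebesgue) + ennreal (3 ^ CARD('n)) * ?B * emeasure lebesgue ?Q)"
    by (simp add: nn_integral_add nn_integral_cmult nn_integral_cmult_indicator)
  also have "\<dots> = ennreal p * (r * (\<integral>\<^sup>+y\<in>?Q. ?F1 y \<partial>lebesgue)) + ennreal (3 ^ CARD('n)) * ?B"
    unfolding distrib_left mult.left_commute[of r "ennreal p"]
    unfolding r_def inverse_vol_mult_emeasure[OF h] ..
  also have "\<dots> \<le> ennreal K * ?B + ennreal (3 ^ CARD('n)) * ?B"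
  proof (rule add_right_mono)
    have "ennreal p * (r * (\<integral>\<^sup>+y\<in>?Q. ?F1 y \<partial>lebesgue)) \<le>
        ennreal (vol ?T powr (\<alpha> / real CARD('n))) * (ennreal K * LlogL_norm f ?T)"
      unfolding p_def by (rule mult_mono[OF vol_powr_mono[OF \<alpha> h] loc]) (use h in auto)
    also have "\<dots> = ennreal K * (ennreal (vol ?T powr (\<alpha> / real CARD('n))) * LlogL_norm f ?T)"
      by (rule mult.left_commute)
    also have "\<dots> \<le> ennreal K * ?B"
      by (intro mult_left_mono le_SUP_cubes_at[OF h3 xT]) simp
    finally show "ennreal p * (r * (\<integral>\<^sup>+y\<in>?Q. ?F1 y \<partial>lebesgue)) \<le> ennreal K * ?B" .
  qed
  also have "\<dots> = ennreal (K + 3 ^ CARD('n)) * ?B"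
    using K by (simp add: distrib_right)
  finally show "ennreal (vol ?Q powr ((\<alpha> - real CARD('n)) / real CARD('n))) * (\<integral>\<^sup>+y\<in>?Q. HL_maximal f y \<partial>lebesgue)
      \<le> ennreal (K + 3 ^ CARD('n)) * ?B" .
qed

text \<open>
  The integral over \<open>Q\<close> is bounded by that of the maximal function over \<open>3Q\<close>, which is again a cube
  containing \<open>x\<close>.
\<close>

lemma LlogL_mean_le_frac_maximal_HL:
  fixes f :: "real ^ 'n \<Rightarrow> real"
  assumes f: "locally_integrable f" and \<alpha>: "0 \<le> \<alpha>"
  shows "(SUP Q\<in>cubes_at x. ennreal (vol Q powr ((\<alpha> - real CARD('n)) / real CARD('n))) *
        (\<integral>\<^sup>+y\<in>Q. ennreal (LlogL_integrand f Q y) \<partial>lebesgue)) \<le>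
    ennreal (3 ^ CARD('n) * (1 + 2 * (5 * real CARD('n)) ^ CARD('n))) * frac_maximal \<alpha> (HL_maximal f) x"
proof (rule SUP_cubes_at_le)
  fix c :: "real ^ 'n" and h :: real
  assume h: "h > 0" and x: "x \<in> cube c h"
  let ?Q = "cube c h" and ?T = "cube c (3 * h)" and ?w = "abs_avg f (cube c h)"
  let ?D = "(5 * real CARD('n)) ^ CARD('n)" and ?M = "HL_maximal f"
  have fm [measurable]: "f \<in> borel_measurable lebesgue" by (rule locally_integrable_measurable[OF f])
  have h3: "3 * h > 0" and sub: "?Q \<subseteq> ?T" using h cube_mono[of h "3 * h" c] by auto
  have xT: "x \<in> ?T" using x sub by auto
  have "(\<integral>\<^sup>+y\<in>?Q. ennreal (LlogL_integrand f ?Q y) \<partial>lebesgue) \<le>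
      ennreal (1 + 2 * ?D) * (\<integral>\<^sup>+y\<in>?T. ?M y \<partial>lebesgue)"
  proof (cases "?w = 0")
    case True
    then show ?thesis by (simp add: LlogL_integrand_def)
  next
    case False
    then have w: "?w > 0" using abs_avg_nonneg[of f ?Q] by simp
    have wM: "ennreal ?w \<le> ?M y" if "y \<in> ?Q" for y
      using average_le_maximal[OF h that, of "\<lambda>y. ennreal \<bar>f y\<bar>"]
      unfolding nn_integral_eq_abs_avg[OF f h] inverse_vol_mult_emeasure[OF h] HL_maximal_def .
    have "(\<integral>\<^sup>+y\<in>?Q. ennreal \<bar>f y\<bar> \<partial>lebesgue) = (\<integral>\<^sup>+y. ennreal ?w * indicator ?Q y \<partial>lebesgue)"
      unfolding nn_integral_eq_abs_avg[OF f h] by (simp add: nn_integral_cmult_indicator)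
    also have "\<dots> \<le> (\<integral>\<^sup>+y\<in>?T. ?M y \<partial>lebesgue)"
      using wM sub by (intro nn_integral_mono) (auto split: split_indicator)
    finally have lin: "(\<integral>\<^sup>+y\<in>?Q. ennreal \<bar>f y\<bar> \<partial>lebesgue) \<le> (\<integral>\<^sup>+y\<in>?T. ?M y \<partial>lebesgue)" .
    have "(\<integral>\<^sup>+y\<in>?Q. ennreal (LlogL_integrand f ?Q y) \<partial>lebesgue) =
        (\<integral>\<^sup>+y. ennreal \<bar>f y\<bar> * indicator ?Q y + ennreal (\<bar>f y\<bar> * log_plus (\<bar>f y\<bar> / ?w)) * indicator ?Q y \<partial>lebesgue)"
      using w by (intro nn_integral_cong)
        (auto simp: LlogL_integrand_def distrib_left log_plus_nonneg split: split_indicator)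
    also have "\<dots> = (\<integral>\<^sup>+y\<in>?Q. ennreal \<bar>f y\<bar> \<partial>lebesgue) +
        (\<integral>\<^sup>+y\<in>?Q. ennreal (\<bar>f y\<bar> * log_plus (\<bar>f y\<bar> / ?w)) \<partial>lebesgue)"
      by (rule nn_integral_add) measurable
    also have "\<dots> \<le> (\<integral>\<^sup>+y\<in>?T. ?M y \<partial>lebesgue) + ennreal (2 * ?D) * (\<integral>\<^sup>+y\<in>?T. ?M y \<partial>lebesgue)"
      using integral_log_plus_le_maximal[OF fm w h nn_integral_eq_abs_avg[OF f h]] lin
      unfolding HL_maximal_def by (intro add_mono)
    also have "\<dots> = ennreal (1 + 2 * ?D) * (\<integral>\<^sup>+y\<in>?T. ?M y \<partial>lebesgue)"
      by (simp add: distrib_right)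
    finally show ?thesis .
  qed
  then have "ennreal (1 / vol ?Q) * (\<integral>\<^sup>+y\<in>?Q. ennreal (LlogL_integrand f ?Q y) \<partial>lebesgue) \<le>
      ennreal (1 / vol ?Q) * (ennreal (1 + 2 * ?D) * (\<integral>\<^sup>+y\<in>?T. ?M y \<partial>lebesgue))"
    by (rule mult_left_mono) simp
  also have "\<dots> = ennreal (3 ^ CARD('n)) * ennreal (1 + 2 * ?D) * (ennreal (1 / vol ?T) * (\<integral>\<^sup>+y\<in>?T. ?M y \<partial>lebesgue))"
    unfolding inverse_vol_dilate[OF h] by (simp only: mult_ac)
  also have "\<dots> = ennreal (3 ^ CARD('n) * (1 + 2 * ?D)) * (ennreal (1 / vol ?T) * (\<integral>\<^sup>+y\<in>?T. ?M y \<partial>lebesgue))"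
    by (subst ennreal_mult[symmetric]) auto
  finally have le: "ennreal (1 / vol ?Q) * (\<integral>\<^sup>+y\<in>?Q. ennreal (LlogL_integrand f ?Q y) \<partial>lebesgue) \<le>
    ennreal (3 ^ CARD('n) * (1 + 2 * ?D)) * (ennreal (1 / vol ?T) * (\<integral>\<^sup>+y\<in>?T. ?M y \<partial>lebesgue))" .
  have "ennreal (vol ?Q powr ((\<alpha> - real CARD('n)) / real CARD('n))) *
        (\<integral>\<^sup>+y\<in>?Q. ennreal (LlogL_integrand f ?Q y) \<partial>lebesgue) \<le>
      ennreal (vol ?T powr (\<alpha> / real CARD('n))) *
        (ennreal (3 ^ CARD('n) * (1 + 2 * ?D)) * (ennreal (1 / vol ?T) * (\<integral>\<^sup>+y\<in>?T. ?M y \<partial>lebesgue)))"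
    unfolding scale_vol_powr[OF h] by (rule mult_mono[OF vol_powr_mono[OF \<alpha> h] le]) (use h in auto)
  also have "\<dots> = ennreal (3 ^ CARD('n) * (1 + 2 * ?D)) *
      (ennreal (vol ?T powr ((\<alpha> - real CARD('n)) / real CARD('n))) * (\<integral>\<^sup>+y\<in>?T. ?M y \<partial>lebesgue))"
    unfolding scale_vol_powr[OF h3] by (rule mult.left_commute)
  also have "\<dots> \<le> ennreal (3 ^ CARD('n) * (1 + 2 * ?D)) * frac_maximal \<alpha> ?M x"
    unfolding frac_maximal_def[of \<alpha>] by (intro mult_left_mono le_SUP_cubes_at[OF h3 xT]) simp
  finally show "ennreal (vol ?Q powr ((\<alpha> - real CARD('n)) / real CARD('n))) *
        (\<integral>\<^sup>+y\<in>?Q. ennreal (LlogL_integrand f ?Q y) \<partial>lebesgue) \<le>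
      ennreal (3 ^ CARD('n) * (1 + 2 * ?D)) * frac_maximal \<alpha> ?M x" .
qed

lemma ennreal_inverse_mult_le_iff:
  assumes "c > 0"
  shows "ennreal (inverse c) * B \<le> A \<longleftrightarrow> B \<le> ennreal c * A"
proof
  assume "ennreal (inverse c) * B \<le> A"
  then have "ennreal c * (ennreal (inverse c) * B) \<le> ennreal c * A" by (rule mult_left_mono) simp
  then show "B \<le> ennreal c * A"
    using assms by (simp add: mult.assoc[symmetric] ennreal_mult[symmetric])
next
  assume "B \<le> ennreal c * A"
  then have "ennreal (inverse c) * B \<le> ennreal (inverse c) * (ennreal c * A)" by (rule mult_left_mono) simp
  then show "ennreal (inverse c) * B \<le> A"
    using assms by (simp add: mult.assoc[symmetric] ennreal_mult[symmetric])
qed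

theorem theorem4p1:
  fixes \<alpha> :: real
  assumes "0 \<le> \<alpha>" and "\<alpha> < real CARD('n::finite)"
  shows "\<exists>c\<^sub>1 > 0. \<exists>c\<^sub>2 > 0. \<forall>(f :: real ^ 'n \<Rightarrow> real) (x :: real ^ 'n). locally_integrable f \<longrightarrow>
    frac_maximal \<alpha> (HL_maximal f) x =
      (SUP Q\<in>cubes_at x.
        ennreal (vol Q powr ((\<alpha> - real CARD('n)) / real CARD('n))) *
        (\<integral>\<^sup>+ y\<in>Q. HL_maximal f y \<partial>lebesgue)) \<and>
    equiv_with c\<^sub>1
      (frac_maximal \<alpha> (HL_maximal f) x)
      (SUP Q\<in>cubes_at x. ennreal (vol Q powr (\<alpha> / real CARD('n))) * LlogL_norm f Q) \<and>
    equiv_with c\<^sub>2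
      (SUP Q\<in>cubes_at x. ennreal (vol Q powr (\<alpha> / real CARD('n))) * LlogL_norm f Q)
      (SUP Q\<in>cubes_at x.
        ennreal (vol Q powr ((\<alpha> - real CARD('n)) / real CARD('n))) *
        (\<integral>\<^sup>+ y\<in>Q. ennreal (LlogL_integrand f Q y) \<partial>lebesgue))"
proof -
  define K\<^sub>1 where "K\<^sub>1 = 1 + 4 * (5 * real CARD('n)) ^ CARD('n) * 3 ^ CARD('n) + 3 ^ CARD('n)"
  define K\<^sub>2 where "K\<^sub>2 = 3 ^ CARD('n) * (1 + 2 * (5 * real CARD('n)) ^ CARD('n))"
  let ?A = "\<lambda>f x. frac_maximal \<alpha> (HL_maximal f) (x :: real ^ 'n)"
  let ?B = "\<lambda>f x. SUP Q\<in>cubes_at (x :: real ^ 'n). ennreal (vol Q powr (\<alpha> / real CARD('n))) * LlogL_norm f Q"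
  let ?C = "\<lambda>f x. SUP Q\<in>cubes_at (x :: real ^ 'n). ennreal (vol Q powr ((\<alpha> - real CARD('n)) / real CARD('n))) *
        (\<integral>\<^sup>+ y\<in>Q. ennreal (LlogL_integrand f Q y) \<partial>lebesgue)"
  have K: "max K\<^sub>1 K\<^sub>2 > 0"
    by (simp add: K\<^sub>1_def add_pos_nonneg less_max_iff_disj)
  have "?B f x \<le> ?C f x" if f: "locally_integrable f" for f x
    using f by (intro SUP_cubes_at_le order_trans[OF _ le_SUP_cubes_at])
      (auto simp only: scale_vol_powr intro!: mult_left_mono LlogL_norm_le_mean zero_le)
  moreover have "?C f x \<le> ennreal 2 * ?B f x" if f: "locally_integrable f" for f x
  proof (rule SUP_cubes_at_le)
    fix c h assume h: "h > 0" and x: "x \<in> cube c h"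
    have "ennreal (vol (cube c h) powr ((\<alpha> - real CARD('n)) / real CARD('n))) *
        (\<integral>\<^sup>+ y\<in>cube c h. ennreal (LlogL_integrand f (cube c h) y) \<partial>lebesgue) \<le>
      ennreal (vol (cube c h) powr (\<alpha> / real CARD('n))) * (2 * LlogL_norm f (cube c h))"
      unfolding scale_vol_powr[OF h] by (intro mult_left_mono mean_le_LlogL_norm f h) simp
    also have "\<dots> = 2 * (ennreal (vol (cube c h) powr (\<alpha> / real CARD('n))) * LlogL_norm f (cube c h))"
      by (rule mult.left_commute)
    also have "\<dots> \<le> 2 * ?B f x"
      by (intro mult_left_mono le_SUP_cubes_at[OF h x]) simp
    finally show "ennreal (vol (cube c h) powr ((\<alpha> - real CARD('n)) / real CARD('n))) *
        (\<integral>\<^sup>+ y\<in>cube c h. ennreal (LlogL_integrand f (cube c h) y) \<partial>lebesgue) \<le> ennreal 2 * ?B f x"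
      by simp
  qed
  moreover have "?A f x \<le> ennreal K\<^sub>1 * ?B f x" if f: "locally_integrable f" for f x
    unfolding K\<^sub>1_def by (rule frac_maximal_HL_le_LlogL_norm[OF f assms(1)])
  moreover have "?C f x \<le> ennreal K\<^sub>2 * ?A f x" if f: "locally_integrable f" for f x
    unfolding K\<^sub>2_def by (rule LlogL_mean_le_frac_maximal_HL[OF f assms(1)])
  moreover have "ennreal K\<^sub>1 * b \<le> ennreal (max K\<^sub>1 K\<^sub>2) * b" "ennreal K\<^sub>2 * b \<le> ennreal (max K\<^sub>1 K\<^sub>2) * b" for b
    by (intro mult_right_mono ennreal_leI; simp)+
  moreover have "b \<le> ennreal 2 * b" for b :: ennreal
    by (simp add: mult_2)
  ultimately have "equiv_with (max K\<^sub>1 K\<^sub>2) (?A f x) (?B f x) \<and> equiv_with 2 (?B f x) (?C f x)"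
    if "locally_integrable f" for f x
    unfolding equiv_with_def ennreal_inverse_mult_le_iff[OF K] ennreal_inverse_mult_le_iff[OF zero_less_numeral]
    using that by (meson order_trans)
  then show ?thesis
    using K by (intro exI[of _ "max K\<^sub>1 K\<^sub>2"] exI[of _ 2] conjI) (auto simp: frac_maximal_def)
qed

end
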